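(* Let $W:\mathbb{R}\to\mathbb{R}$ satisfy: (1) $W\ge 0$ and $W(u)=0$ if and only if $u\in\{-1,1\}$; (2) $W=W_{vex}+W_{conc}$ where $W_{conc}$ is concave and $W_{vex}$ is convex; (3) $W_{conc},W_{vex}\in C^1(\mathbb{R})$; and (4) $W_{vex},W_{conc}$ jointly satisfy the uniform curvature condition \[ W(u)\ \geq\ W(U)+\big(W_{vex}'(U)+W_{conc}'(u)\big)(u-U)+\bar c_W\,|u-U|^p\qquad\text{for all } u,U\in\mathbb{R} \] for some $\bar c_W>0$ and $p\geq 2$. Let $u_0\in H^1(\Omega)$, let $\tau,\varepsilon>0$, and let $u_1,u_2,\dots$ be the sequence generated from $u_0$ by the gradient descent scheme associated with the convex-concave splitting of $W$, i.e. \[ u_{n+1}=u_n+\tau\left(\Delta u_{n+1}-\frac{W_{vex}'(u_{n+1})+W_{conc}'(u_n)}{\varepsilon^2}\right),\qquad n\geq 0. \] Then \[ \|u_N-u_0\|_{L^p(\Omega)}\ \leq\ E_\varepsilon(u_0)^{1/p}\left(N\,\varepsilon^{\frac{1}{p-1}}\right)^{1-\frac1p}. \]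
   Context: $\Omega$ is the spatial domain and \[ E_\varepsilon(u)=\int_\Omega\frac{\varepsilon}{2}\|\nabla u\|^2+\frac{W(u)}{\varepsilon}\,dx . \] One of the following boundary conditions is fixed and used throughout: (1) Dirichlet conditions $u\equiv 1$ on a relatively open and closed subset $\Gamma\subseteq\partial\Omega$ and $u\equiv-1$ on $\partial\Omega\setminus\Gamma$; (2) homogeneous Neumann conditions $\partial_\nu u=0$ on $\partial\Omega$; (3) periodic boundary conditions. The equation for $u_{n+1}$ is solved subject to this boundary condition, and in the Dirichlet and periodic cases $u_0$ also belongs to the corresponding (affine) subspace of $H^1(\Omega)$. The step $u_{n+1}$ is characterized as the unique minimizer of the strictly convex functional \[ u\mapsto \int_\Omega\frac{\varepsilon}{2}\|\nabla u\|^2+\frac{W_{vex}(u)+W_{conc}'(u_n)\,u}{\varepsilon}+\frac{\varepsilon}{2\tau}(u-u_n)^2\,dx \] in that class, with the displayed time-step equation as its Euler-Lagrange equation. $N\geq 1$ denotes the number of time steps.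
   Formalization: The printed bound, which omits the curvature constant, fails for small curvature constants; the formal statement has E_ε(u_0)/c̄_W in place of E_ε(u_0), which gives the printed inequality whenever c̄_W ≥ 1. *)

theory Defs
  imports "HOL-Analysis.Analysis"
begin

section \<open>The Sobolev space \<open>H\<^sup>1(\<Omega>)\<close>\<close>

text \<open>
  Sobolev functions are represented by Lebesgue measurable functions; everything below depends only
  on their values almost everywhere in \<open>\<Omega>\<close>.  Following Gilbarg and Trudinger, weak derivatives are
  tested against \<open>C\<^sup>1\<^sub>c(\<Omega>)\<close>; by mollification this is the same as testing against
  \<open>C\<^sup>\<infinity>\<^sub>c(\<Omega>)\<close>.  For the same reason \<open>C\<^sup>1\<close> functions may replace smooth ones in the
  closures that define the boundary conditions.
\<close>

definition C1_gradient :: "('a::euclidean_space \<Rightarrow> real) \<Rightarrow> ('a \<Rightarrow> 'a) \<Rightarrow> bool" where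
  "C1_gradient \<phi> D \<longleftrightarrow> (\<forall>x. GDERIV \<phi> x :> D x) \<and> continuous_on UNIV D"

definition compact_support_in :: "'a::euclidean_space set \<Rightarrow> ('a \<Rightarrow> real) \<Rightarrow> bool" where
  "compact_support_in \<Omega> \<phi> \<longleftrightarrow>
     compact (closure {x. \<phi> x \<noteq> 0}) \<and> closure {x. \<phi> x \<noteq> 0} \<subseteq> \<Omega>"

definition L2 :: "'a::euclidean_space set \<Rightarrow> ('a \<Rightarrow> 'b::euclidean_space) \<Rightarrow> bool" where
  "L2 \<Omega> f \<longleftrightarrow>
     f \<in> borel_measurable (lebesgue_on \<Omega>) \<and> integrable (lebesgue_on \<Omega>) (\<lambda>x. (norm (f x))\<^sup>2)"

definition is_weak_gradient ::
    "'a::euclidean_space set \<Rightarrow> ('a \<Rightarrow> real) \<Rightarrow> ('a \<Rightarrow> 'a) \<Rightarrow> bool" where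
  "is_weak_gradient \<Omega> u G \<longleftrightarrow> L2 \<Omega> G \<and>
     (\<forall>\<phi> D. C1_gradient \<phi> D \<and> compact_support_in \<Omega> \<phi> \<longrightarrow>
        (LINT x|lebesgue_on \<Omega>. u x *\<^sub>R D x) = - (LINT x|lebesgue_on \<Omega>. \<phi> x *\<^sub>R G x))"

definition H1 :: "'a::euclidean_space set \<Rightarrow> ('a \<Rightarrow> real) set" where
  "H1 \<Omega> = {u. L2 \<Omega> u \<and> (\<exists>G. is_weak_gradient \<Omega> u G)}"

text \<open>The weak gradient is unique up to a null set; \<open>wgrad\<close> picks a representative.\<close>

definition wgrad :: "'a::euclidean_space set \<Rightarrow> ('a \<Rightarrow> real) \<Rightarrow> 'a \<Rightarrow> 'a" where
  "wgrad \<Omega> u = (SOME G. is_weak_gradient \<Omega> u G)"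

definition H1_norm :: "'a::euclidean_space set \<Rightarrow> ('a \<Rightarrow> real) \<Rightarrow> real" where
  "H1_norm \<Omega> u = sqrt (LINT x|lebesgue_on \<Omega>. (u x)\<^sup>2 + (norm (wgrad \<Omega> u x))\<^sup>2)"

definition H1_closure :: "'a::euclidean_space set \<Rightarrow> ('a \<Rightarrow> real) set \<Rightarrow> ('a \<Rightarrow> real) set" where
  "H1_closure \<Omega> S = {u \<in> H1 \<Omega>. \<exists>\<phi>. (\<forall>k::nat. \<phi> k \<in> S \<inter> H1 \<Omega>) \<and>
                        (\<lambda>k. H1_norm \<Omega> (\<lambda>x. u x - \<phi> k x)) \<longlonglongrightarrow> 0}"

section \<open>Boundary conditions\<close>

datatype 'a boundary_condition =
    Dirichlet "'a set"  \<comment> \<open>the part \<open>\<Gamma>\<close> of the boundary carrying the value 1\<close>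
  | Neumann
  | Periodic 'a 'a  \<comment> \<open>lower and upper corner of the periodicity cell\<close>

fun valid_bc :: "'a::euclidean_space set \<Rightarrow> 'a boundary_condition \<Rightarrow> bool" where
  "valid_bc \<Omega> (Dirichlet \<Gamma>) \<longleftrightarrow>
     openin (top_of_set (frontier \<Omega>)) \<Gamma> \<and> closedin (top_of_set (frontier \<Omega>)) \<Gamma>"
| "valid_bc \<Omega> Neumann \<longleftrightarrow> True"
| "valid_bc \<Omega> (Periodic a b) \<longleftrightarrow> \<Omega> = box a b"

definition periodic_C1 :: "'a::euclidean_space \<Rightarrow> 'a \<Rightarrow> ('a \<Rightarrow> real) set" where
  "periodic_C1 a b = {\<phi>. (\<exists>D. C1_gradient \<phi> D) \<and>
     (\<forall>x. \<forall>i\<in>Basis. \<phi> (x + ((b - a) \<bullet> i) *\<^sub>R i) = \<phi> x)}"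

text \<open>
  The class in which a time step is solved.  Dirichlet values are attained in the sense of
  \<open>H\<^sup>1(\<Omega>)\<close>, as limits of \<open>C\<^sup>1\<close> functions having these boundary values.
  The Neumann condition is the natural one: it restricts neither the class nor the test
  functions and is enforced by the weak equation.
\<close>

fun admissible :: "'a::euclidean_space set \<Rightarrow> 'a boundary_condition \<Rightarrow> ('a \<Rightarrow> real) set" where
  "admissible \<Omega> (Dirichlet \<Gamma>) = H1_closure \<Omega>
     {\<phi>. (\<exists>D. C1_gradient \<phi> D) \<and> (\<forall>x\<in>\<Gamma>. \<phi> x = 1) \<and> (\<forall>x\<in>frontier \<Omega> - \<Gamma>. \<phi> x = -1)}"
| "admissible \<Omega> Neumann = H1 \<Omega>"
| "admissible \<Omega> (Periodic a b) = H1_closure \<Omega> (periodic_C1 a b)"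

fun test_space :: "'a::euclidean_space set \<Rightarrow> 'a boundary_condition \<Rightarrow> ('a \<Rightarrow> real) set" where
  "test_space \<Omega> (Dirichlet \<Gamma>) = H1_closure \<Omega>
     {\<phi>. (\<exists>D. C1_gradient \<phi> D) \<and> compact_support_in \<Omega> \<phi>}"
| "test_space \<Omega> Neumann = H1 \<Omega>"
| "test_space \<Omega> (Periodic a b) = H1_closure \<Omega> (periodic_C1 a b)"

section \<open>The energy and the time-stepping scheme\<close>

text \<open>
  Without growth conditions \<open>W(u)\<close> need not be integrable, so the energy of a potential
  \<open>W \<ge> 0\<close> takes values in \<open>[0, \<infinity>]\<close>.
\<close>

definition energy ::
    "'a::euclidean_space set \<Rightarrow> real \<Rightarrow> (real \<Rightarrow> real) \<Rightarrow> ('a \<Rightarrow> real) \<Rightarrow> ennreal" where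
  "energy \<Omega> \<epsilon> W u =
     (\<integral>\<^sup>+x. ennreal (\<epsilon> / 2 * (norm (wgrad \<Omega> u x))\<^sup>2 + W (u x) / \<epsilon>) \<partial>lebesgue_on \<Omega>)"

definition step_integrand ::
    "'a::euclidean_space set \<Rightarrow> real \<Rightarrow> real \<Rightarrow> (real \<Rightarrow> real) \<Rightarrow> (real \<Rightarrow> real) \<Rightarrow>
     ('a \<Rightarrow> real) \<Rightarrow> ('a \<Rightarrow> real) \<Rightarrow> 'a \<Rightarrow> real" where
  "step_integrand \<Omega> \<epsilon> \<tau> Wvex Wconc w u x =
     \<epsilon> / 2 * (norm (wgrad \<Omega> u x))\<^sup>2 + (Wvex (u x) + deriv Wconc (w x) * u x) / \<epsilon>
       + \<epsilon> / (2 * \<tau>) * (u x - w x)\<^sup>2"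

text \<open>
  \<open>v\<close> minimizes the functional with the above integrand: the functional has values in
  \<open>(-\<infinity>, \<infinity>]\<close> on the admissible class and attains a finite minimum at \<open>v\<close>.
  (\<open>ennreal\<close> maps negative numbers to 0, so the first integral in the second conjunct is that of
  the negative part; where the integrand is not integrable, the functional is \<open>\<infinity>\<close>.)
  Uniqueness of the minimizer is automatic by strict convexity.
\<close>

definition step_minimizer ::
    "'a::euclidean_space set \<Rightarrow> 'a boundary_condition \<Rightarrow> real \<Rightarrow> real \<Rightarrow>
     (real \<Rightarrow> real) \<Rightarrow> (real \<Rightarrow> real) \<Rightarrow> ('a \<Rightarrow> real) \<Rightarrow> ('a \<Rightarrow> real) \<Rightarrow> bool" where
  "step_minimizer \<Omega> bc \<epsilon> \<tau> Wvex Wconc w v \<longleftrightarrow>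
     (let J = step_integrand \<Omega> \<epsilon> \<tau> Wvex Wconc w in
        integrable (lebesgue_on \<Omega>) (J v) \<and>
        (\<forall>u \<in> admissible \<Omega> bc.
           (\<integral>\<^sup>+x. ennreal (- J u x) \<partial>lebesgue_on \<Omega>) < \<infinity> \<and>
           (integrable (lebesgue_on \<Omega>) (J u) \<longrightarrow>
              (LINT x|lebesgue_on \<Omega>. J v x) \<le> (LINT x|lebesgue_on \<Omega>. J u x))))"

text \<open>
  Weak form of \<open>v = w + \<tau> (\<Delta>v - (W\<^sub>v\<^sub>e\<^sub>x'(v) + W\<^sub>c\<^sub>o\<^sub>n\<^sub>c'(w)) / \<epsilon>\<^sup>2)\<close>, tested whenever
  the nonlinear term is integrable against the test function.
\<close>

definition step_equation ::
    "'a::euclidean_space set \<Rightarrow> 'a boundary_condition \<Rightarrow> real \<Rightarrow> real \<Rightarrow>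
     (real \<Rightarrow> real) \<Rightarrow> (real \<Rightarrow> real) \<Rightarrow> ('a \<Rightarrow> real) \<Rightarrow> ('a \<Rightarrow> real) \<Rightarrow> bool" where
  "step_equation \<Omega> bc \<epsilon> \<tau> Wvex Wconc w v \<longleftrightarrow>
     (\<forall>\<phi> \<in> test_space \<Omega> bc.
        integrable (lebesgue_on \<Omega>) (\<lambda>x. (deriv Wvex (v x) + deriv Wconc (w x)) * \<phi> x) \<longrightarrow>
        (LINT x|lebesgue_on \<Omega>. (v x - w x) * \<phi> x) =
          \<tau> * (- (LINT x|lebesgue_on \<Omega>. wgrad \<Omega> v x \<bullet> wgrad \<Omega> \<phi> x)
               - (LINT x|lebesgue_on \<Omega>. (deriv Wvex (v x) + deriv Wconc (w x)) * \<phi> x) / \<epsilon>\<^sup>2))"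

definition scheme_step ::
    "'a::euclidean_space set \<Rightarrow> 'a boundary_condition \<Rightarrow> real \<Rightarrow> real \<Rightarrow>
     (real \<Rightarrow> real) \<Rightarrow> (real \<Rightarrow> real) \<Rightarrow> ('a \<Rightarrow> real) \<Rightarrow> ('a \<Rightarrow> real) \<Rightarrow> bool" where
  "scheme_step \<Omega> bc \<epsilon> \<tau> Wvex Wconc w v \<longleftrightarrow>
     v \<in> admissible \<Omega> bc \<and>
     step_equation \<Omega> bc \<epsilon> \<tau> Wvex Wconc w v \<and>
     step_minimizer \<Omega> bc \<epsilon> \<tau> Wvex Wconc w v"

section \<open>Extended-valued \<open>L\<^sup>p\<close> norms\<close>

text \<open>Meant for exponents \<open>r > 0\<close>, so that \<open>\<infinity>\<close> is mapped to \<open>\<infinity>\<close>.\<close>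

definition ennpowr :: "ennreal \<Rightarrow> real \<Rightarrow> ennreal" where
  "ennpowr t r = (if t = \<infinity> then \<infinity> else ennreal (enn2real t powr r))"

definition Lp_norm :: "'a::euclidean_space set \<Rightarrow> real \<Rightarrow> ('a \<Rightarrow> real) \<Rightarrow> ennreal" where
  "Lp_norm \<Omega> p f = ennpowr (\<integral>\<^sup>+x. ennreal (\<bar>f x\<bar> powr p) \<partial>lebesgue_on \<Omega>) (1 / p)"

text \<open>
  On constants in bounds for this scheme: a displacement bound by the energy has to involve the
  constant \<open>c\<close> of the curvature condition.  Replacing \<open>(W, \<tau>, c)\<close> by
  \<open>(t W, \<tau> / t, t c)\<close> leaves the spatially constant Neumann solutions unchanged, but multiplies
  their energy by \<open>t\<close>.
\<close>

end

theory Submission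
  imports Defs
begin

text \<open>
  Since \<open>W(u)\<close> is only known to be integrable, the products
  \<open>(W\<^sub>v\<^sub>e\<^sub>x'(u\<^sub>n\<^sub>+\<^sub>1) + W\<^sub>c\<^sub>o\<^sub>n\<^sub>c'(u\<^sub>n)) (u\<^sub>n - u\<^sub>n\<^sub>+\<^sub>1)\<close> are not known to be
  integrable a priori and \<open>u\<^sub>n - u\<^sub>n\<^sub>+\<^sub>1\<close> cannot be inserted into the weak equation.  Instead, minimality is used along
  the segment from \<open>u\<^sub>n\<^sub>+\<^sub>1\<close> to \<open>u\<^sub>n\<close>: concavity of \<open>W\<^sub>c\<^sub>o\<^sub>n\<^sub>c\<close> bounds the step functional at
  \<open>u\<^sub>n\<close> by its minimum plus the energy of \<open>u\<^sub>n\<close>, difference quotients of a convex function are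
  bounded by the one at the far end, and Fatou's lemma makes the directional derivative integrable with
  nonnegative integral.  Adding the curvature condition gives
  \<open>E(u\<^sub>n\<^sub>+\<^sub>1) + c/\<epsilon> \<integral>|u\<^sub>n\<^sub>+\<^sub>1 - u\<^sub>n|\<^sup>p \<le> E(u\<^sub>n)\<close>; summing over \<open>n\<close> and applying the power mean
  inequality pointwise yields the bound.  Segments are admissible because the weak gradient is linear almost
  everywhere, which rests on its uniqueness.
\<close>

section \<open>Square-integrable functions\<close>

lemma norm_lincomb_sq_le:
  fixes x y :: "'b::real_normed_vector"
  shows "(norm (a *\<^sub>R x + b *\<^sub>R y))\<^sup>2 \<le> 2 * a\<^sup>2 * (norm x)\<^sup>2 + 2 * b\<^sup>2 * (norm y)\<^sup>2"
proof -
  have "norm (a *\<^sub>R x + b *\<^sub>R y) \<le> \<bar>a\<bar> * norm x + \<bar>b\<bar> * norm y"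
    by (metis norm_scaleR norm_triangle_ineq)
  then have "(norm (a *\<^sub>R x + b *\<^sub>R y))\<^sup>2 \<le> (\<bar>a\<bar> * norm x + \<bar>b\<bar> * norm y)\<^sup>2"
    by (intro power_mono) auto
  also have "\<dots> \<le> 2 * (\<bar>a\<bar> * norm x)\<^sup>2 + 2 * (\<bar>b\<bar> * norm y)\<^sup>2"
    using sum_squares_bound[of "\<bar>a\<bar> * norm x" "\<bar>b\<bar> * norm y"] by (simp add: power2_sum)
  finally show ?thesis
    by (simp add: power_mult_distrib mult.assoc)
qed

lemma L2_lincomb:
  assumes f: "L2 \<Omega> f" and g: "L2 \<Omega> g"
  shows "L2 \<Omega> (\<lambda>x. a *\<^sub>R f x + b *\<^sub>R g x)"
proof -
  let ?M = "lebesgue_on \<Omega>"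
  have [measurable]: "f \<in> borel_measurable ?M" "g \<in> borel_measurable ?M"
    using f g by (auto simp: L2_def)
  have "integrable ?M (\<lambda>x. 2 * a\<^sup>2 * (norm (f x))\<^sup>2 + 2 * b\<^sup>2 * (norm (g x))\<^sup>2)"
    using f g by (auto simp: L2_def)
  then have "integrable ?M (\<lambda>x. (norm (a *\<^sub>R f x + b *\<^sub>R g x))\<^sup>2)"
    by (rule Bochner_Integration.integrable_bound) (auto intro!: order_trans[OF norm_lincomb_sq_le])
  then show ?thesis
    by (simp add: L2_def)
qed

text \<open>Young's inequality replaces Cauchy-Schwarz: the sum of the squared norms dominates the
  product. It serves all pairings with test functions and with indicators of bounded boxes.\<close>

lemma L2_scaleR_integrable:
  fixes f :: "'a::euclidean_space \<Rightarrow> real" and g :: "'a \<Rightarrow> 'b::euclidean_space"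
  assumes f: "L2 \<Omega> f" and g: "L2 \<Omega> g"
  shows "integrable (lebesgue_on \<Omega>) (\<lambda>x. f x *\<^sub>R g x)"
proof -
  let ?M = "lebesgue_on \<Omega>"
  have [measurable]: "f \<in> borel_measurable ?M" "g \<in> borel_measurable ?M"
    using f g by (auto simp: L2_def)
  have "integrable ?M (\<lambda>x. (norm (f x))\<^sup>2 + (norm (g x))\<^sup>2)"
    using f g unfolding L2_def by (intro Bochner_Integration.integrable_add) auto
  then show ?thesis
  proof (rule Bochner_Integration.integrable_bound)
    show "AE x in ?M. norm (f x *\<^sub>R g x) \<le> norm ((norm (f x))\<^sup>2 + (norm (g x))\<^sup>2)"
    proof (rule AE_I2)
      fix x
      \<comment> \<open>\<open>sum_squares_bound\<close> bounds twice the product; nonnegativity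
        lets the factor 2 be dropped.\<close>
      have "0 \<le> \<bar>f x\<bar> * norm (g x)" by simp
      then have "\<bar>f x\<bar> * norm (g x) \<le> \<bar>f x\<bar>\<^sup>2 + (norm (g x))\<^sup>2"
        using sum_squares_bound[of "\<bar>f x\<bar>" "norm (g x)"] by linarith
      then show "norm (f x *\<^sub>R g x) \<le> norm ((norm (f x))\<^sup>2 + (norm (g x))\<^sup>2)"
        by simp
    qed
  qed measurable
qed

text \<open>Since \<Omega> may have infinite measure, the dominating function is a constant on the
  compact set \<open>K\<close>, which has finite measure.\<close>

lemma L2_continuous_compact_support:
  fixes f :: "'a::euclidean_space \<Rightarrow> 'b::euclidean_space"
  assumes "open \<Omega>" "continuous_on UNIV f" "compact K" and supp: "\<And>x. x \<notin> K \<Longrightarrow> f x = 0"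
  shows "L2 \<Omega> f"
proof -
  have f [measurable]: "f \<in> borel_measurable borel"
    using assms by (intro borel_measurable_continuous_onI)
  have "bounded (f ` K)"
    by (meson assms compact_continuous_image compact_imp_bounded continuous_on_subset subset_UNIV)
  then obtain B where B: "\<And>x. x \<in> K \<Longrightarrow> norm (f x) \<le> B"
    by (auto simp: bounded_iff)
  have "K \<in> lmeasurable"
    using \<open>compact K\<close> lmeasurable_compact by blast
  then have "integrable lebesgue (\<lambda>x. indicator K x *\<^sub>R B\<^sup>2)"
    by (intro integrable_scaleR_left integrable_real_indicator) (auto simp: fmeasurable_def)
  moreover have fl: "f \<in> borel_measurable lebesgue"
    by (simp add: f measurable_completion)
  moreover have "AE x in lebesgue. norm ((norm (f x))\<^sup>2) \<le> norm (indicator K x *\<^sub>R B\<^sup>2)"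
  proof (rule AE_I2)
    fix x show "norm ((norm (f x))\<^sup>2) \<le> norm (indicator K x *\<^sub>R B\<^sup>2)"
      using B[of x] supp[of x] by (cases "x \<in> K") (auto intro: power_mono)
  qed
  moreover have "(\<lambda>x. (norm (f x))\<^sup>2) \<in> borel_measurable lebesgue"
    using fl by measurable
  ultimately have "integrable lebesgue (\<lambda>x. (norm (f x))\<^sup>2)"
    by (rule_tac Bochner_Integration.integrable_bound)
  moreover have "\<Omega> \<in> sets lebesgue"
    using \<open>open \<Omega>\<close> by (simp add: borel_open)
  ultimately have "integrable (lebesgue_on \<Omega>) (\<lambda>x. (norm (f x))\<^sup>2)"
    by (subst integrable_restrict_space) (simp, rule integrable_mult_indicator)
  then show ?thesis
    using fl by (auto simp: L2_def intro: measurable_restrict_space1)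
qed

section \<open>Test functions\<close>

lemma C1_gradient_continuous: "C1_gradient \<phi> D \<Longrightarrow> continuous_on UNIV \<phi>"
  unfolding C1_gradient_def gderiv_def
  by (blast intro: continuous_at_imp_continuous_on has_derivative_continuous)

text \<open>Off its closed support \<phi> vanishes on a whole neighbourhood, so uniqueness of
  derivatives forces a zero gradient. Thus \<open>D\<close> inherits the compact support.\<close>

lemma C1_gradient_supported:
  assumes "C1_gradient \<phi> D" "x \<notin> closure {x. \<phi> x \<noteq> 0}"
  shows "D x = 0"
proof -
  let ?S = "closure {x. \<phi> x \<noteq> 0}"
  have "((\<lambda>y. 0) has_derivative (\<lambda>h. h \<bullet> D x)) (at x)"
  proof (rule has_derivative_transform_within_open[where s = "- ?S"])
    show "(\<phi> has_derivative (\<lambda>h. h \<bullet> D x)) (at x)"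
      using assms by (simp add: C1_gradient_def gderiv_def)
    show "\<phi> y = 0" if "y \<in> - ?S" for y
      using that closure_subset[of "{x. \<phi> x \<noteq> 0}"] by auto
  qed (use assms in auto)
  then have "(\<lambda>h. h \<bullet> D x) = (\<lambda>h. 0)"
    by (metis has_derivative_const has_derivative_unique)
  then show ?thesis
    by (metis inner_eq_zero_iff)
qed

lemma test_function_L2:
  assumes "open \<Omega>" "C1_gradient \<phi> D" "compact_support_in \<Omega> \<phi>"
  shows "L2 \<Omega> \<phi>" "L2 \<Omega> D"
proof -
  let ?S = "closure {x. \<phi> x \<noteq> 0}"
  have S: "compact ?S"
    using assms by (simp add: compact_support_in_def)
  show "L2 \<Omega> \<phi>"
    using closure_subset[of "{x. \<phi> x \<noteq> 0}"]
    by (intro L2_continuous_compact_support[OF assms(1) C1_gradient_continuous[OF assms(2)] S]) auto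
  show "L2 \<Omega> D"
    using assms(2) C1_gradient_supported
    by (intro L2_continuous_compact_support[OF assms(1) _ S]) (auto simp: C1_gradient_def)
qed

section \<open>Calculus of C^1 functions and cutoffs of boxes\<close>

lemma C1_gradient_mult:
  assumes "C1_gradient f D" "C1_gradient g E"
  shows "C1_gradient (\<lambda>x. f x * g x) (\<lambda>x. f x *\<^sub>R E x + g x *\<^sub>R D x)"
  unfolding C1_gradient_def
proof (intro conjI allI)
  show "GDERIV (\<lambda>x. f x * g x) x :> f x *\<^sub>R E x + g x *\<^sub>R D x" for x
    using assms by (intro GDERIV_mult) (auto simp: C1_gradient_def)
  show "continuous_on UNIV (\<lambda>x. f x *\<^sub>R E x + g x *\<^sub>R D x)"
    using assms C1_gradient_continuous[OF assms(1)] C1_gradient_continuous[OF assms(2)]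
    by (intro continuous_intros) (auto simp: C1_gradient_def)
qed

lemma C1_gradient_compose:
  assumes f: "C1_gradient f D" and h: "\<And>s. (h has_real_derivative h' s) (at s)"
    and h': "continuous_on UNIV h'"
  shows "C1_gradient (\<lambda>x. h (f x)) (\<lambda>x. h' (f x) *\<^sub>R D x)"
  unfolding C1_gradient_def
proof (intro conjI allI)
  show "GDERIV (\<lambda>x. h (f x)) x :> h' (f x) *\<^sub>R D x" for x
    using f by (intro GDERIV_DERIV_compose h) (auto simp: C1_gradient_def)
  show "continuous_on UNIV (\<lambda>x. h' (f x) *\<^sub>R D x)"
    using f C1_gradient_continuous[OF f]
    by (intro continuous_on_scaleR continuous_on_compose2[OF h']) (auto simp: C1_gradient_def)
qed

lemma C1_gradient_prod:
  assumes "finite I" "\<And>i. i \<in> I \<Longrightarrow> \<exists>D. C1_gradient (f i) D"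
  shows "\<exists>D. C1_gradient (\<lambda>x. \<Prod>i\<in>I. f i x) D"
  using assms
proof (induction I rule: finite_induct)
  case empty
  have "C1_gradient (\<lambda>x. 1::real) (\<lambda>x. 0)"
    by (simp add: C1_gradient_def GDERIV_const)
  then show ?case by auto
next
  case (insert i I)
  then obtain D E where "C1_gradient (f i) D" "C1_gradient (\<lambda>x. \<Prod>i\<in>I. f i x) E"
    by blast
  from C1_gradient_mult[OF this] show ?case
    using insert.hyps by auto
qed

text \<open>Squaring removes the kink of the positive part at 0. This gives a C^1 building block for
  cutoffs, which is smooth enough since test functions are only C^1.\<close>

lemma has_real_derivative_pos_part_sq:
  "((\<lambda>s::real. (max 0 s)\<^sup>2) has_real_derivative 2 * max 0 s) (at s)"
proof -
  consider "s > 0" | "s < 0" | "s = 0" by linarith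
  then show ?thesis
  proof cases
    case 1
    have "((\<lambda>s. s\<^sup>2) has_real_derivative 2 * s) (at s)"
      by (auto intro!: derivative_eq_intros)
    then show ?thesis
      using 1 by (subst DERIV_cong_ev[where g = "\<lambda>s. s\<^sup>2"])
        (auto simp: max_def eventually_nhds intro!: exI[of _ "{0<..}"])
  next
    case 2
    then show ?thesis
      by (subst DERIV_cong_ev[where g = "\<lambda>s. 0"])
        (auto simp: max_def eventually_nhds intro!: exI[of _ "{..<0}"])
  next
    case 3
    have "((\<lambda>h::real. max 0 h) \<longlongrightarrow> max 0 0) (at 0)"
      by (intro tendsto_intros)
    \<comment> \<open>The difference quotient at the kink is h on the right and 0 on the
      left.\<close>
    moreover have "\<forall>\<^sub>F h::real in at 0. (max 0 h)\<^sup>2 / h = max 0 h"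
      by (auto simp: eventually_at_filter max_def power2_eq_square)
    ultimately show ?thesis
      using 3 by (simp add: DERIV_def tendsto_cong)
  qed
qed

text \<open>A product of squared positive parts, two per coordinate, gives a C^1 function
  \<open>q\<close> that is positive on the open box and zero elsewhere. Then 1 - exp(-k q) tends to
  1 where \<open>q\<close> is positive and stays 0 where it vanishes.\<close>

lemma box_cutoff:
  fixes a b :: "'a::euclidean_space"
  obtains \<phi> :: "nat \<Rightarrow> 'a \<Rightarrow> real" where
    "\<And>k. \<exists>D. C1_gradient (\<phi> k) D" "\<And>k x. 0 \<le> \<phi> k x" "\<And>k x. \<phi> k x \<le> 1"
    "\<And>k x. x \<notin> box a b \<Longrightarrow> \<phi> k x = 0" "\<And>x. (\<lambda>k. \<phi> k x) \<longlonglongrightarrow> indicator (box a b) x"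
proof -
  define r where "r i s = (max 0 (s - a \<bullet> i))\<^sup>2 * (max 0 (b \<bullet> i - s))\<^sup>2" for i s
  define q where "q x = (\<Prod>i\<in>Basis. r i (x \<bullet> i))" for x
  define \<phi> where "\<phi> k x = 1 - exp (- real k * q x)" for k x
  have r: "\<exists>D. C1_gradient (\<lambda>x. r i (x \<bullet> i)) D" for i
  proof -
    have "C1_gradient (\<lambda>x. x \<bullet> i) (\<lambda>x. i)"
      by (auto simp: C1_gradient_def gderiv_def intro!: derivative_eq_intros)
    moreover have "(r i has_real_derivative
        (2 * max 0 (s - a \<bullet> i)) * 1 * (max 0 (b \<bullet> i - s))\<^sup>2
        + (2 * max 0 (b \<bullet> i - s)) * (- 1) * (max 0 (s - a \<bullet> i))\<^sup>2) (at s)" for s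
      unfolding r_def
      by (rule DERIV_mult; rule DERIV_chain2[OF has_real_derivative_pos_part_sq])
        (auto intro!: derivative_eq_intros)
    ultimately have "C1_gradient (\<lambda>x. r i (x \<bullet> i)) (\<lambda>x.
        ((2 * max 0 (x \<bullet> i - a \<bullet> i)) * 1 * (max 0 (b \<bullet> i - x \<bullet> i))\<^sup>2
        + (2 * max 0 (b \<bullet> i - x \<bullet> i)) * (- 1) * (max 0 (x \<bullet> i - a \<bullet> i))\<^sup>2) *\<^sub>R i)"
      by (rule C1_gradient_compose) (intro continuous_intros)
    then show ?thesis
      by blast
  qed
  have q: "\<exists>D. C1_gradient q D"
    unfolding q_def by (intro C1_gradient_prod r) auto
  have q_nonneg: "q x \<ge> 0" for x
    unfolding q_def r_def by (intro prod_nonneg) auto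
  have q_pos: "q x > 0" if "x \<in> box a b" for x
    using that unfolding q_def r_def by (intro prod_pos) (auto simp: mem_box)
  have q_zero: "q x = 0" if x: "x \<notin> box a b" for x
  proof -
    from x obtain i where i: "i \<in> Basis" "x \<bullet> i \<le> a \<bullet> i \<or> b \<bullet> i \<le> x \<bullet> i"
      by (auto simp: mem_box not_less)
    then have "r i (x \<bullet> i) = 0"
      by (auto simp: r_def max_def)
    with i show ?thesis
      by (auto simp: q_def)
  qed
  show ?thesis
  proof
    fix k
    have "((\<lambda>s. 1 - exp (- real k * s)) has_real_derivative real k * exp (- real k * s)) (at s)" for s
      by (auto intro!: derivative_eq_intros)
    moreover obtain D where "C1_gradient q D"
      using q by blast
    ultimately have "C1_gradient (\<lambda>x. 1 - exp (- real k * q x)) (\<lambda>x. (real k * exp (- real k * q x)) *\<^sub>R D x)"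
      by (intro C1_gradient_compose) (assumption, blast, intro continuous_intros)
    then show "\<exists>D. C1_gradient (\<phi> k) D"
      unfolding \<phi>_def by blast
  next
    fix x
    show "(\<lambda>k. \<phi> k x) \<longlonglongrightarrow> indicator (box a b) x"
    proof (cases "x \<in> box a b")
      case True
      have "(\<lambda>k. exp (- q x) ^ k) \<longlonglongrightarrow> 0"
        using q_pos[OF True] by (intro LIMSEQ_power_zero) auto
      \<comment> \<open>Inside the box the exponential is a geometric sequence with ratio below
        1.\<close>
      moreover have "exp (- q x) ^ k = exp (- real k * q x)" for k
        by (simp flip: exp_of_nat_mult)
      ultimately have "(\<lambda>k. 1 - exp (- real k * q x)) \<longlonglongrightarrow> 1 - 0"
        by (intro tendsto_diff) auto
      then show ?thesis
        using True by (simp add: \<phi>_def)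
    qed (simp add: \<phi>_def q_zero)
  qed (auto simp: \<phi>_def q_zero q_nonneg)
qed

section \<open>Weak gradients\<close>

text \<open>By Lebesgue differentiation, at almost every point the averages over shrinking cubes
  with that point as lower corner converge to the value of \<open>f\<close>. Here all these averages
  vanish.\<close>

lemma AE_zero_if_box_integrals_zero:
  fixes f :: "'a::euclidean_space \<Rightarrow> 'b::euclidean_space"
  assumes "open \<Omega>"
    and int: "\<And>a b. cbox a b \<subseteq> \<Omega> \<Longrightarrow> f integrable_on cbox a b"
    and zero: "\<And>a b. cbox a b \<subseteq> \<Omega> \<Longrightarrow> integral (cbox a b) f = 0"
  shows "AE x in lebesgue_on \<Omega>. f x = 0"
proof -
  have neg: "negligible {x \<in> cbox a b. f x \<noteq> 0}" if ab: "cbox a b \<subseteq> \<Omega>" for a b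
  proof -
    \<comment> \<open>The differentiation theorem wants integrability on every closed box; extension
      by zero provides it.\<close>
    define g where "g x = (if x \<in> cbox a b then f x else 0)" for x
    have "g integrable_on UNIV"
      unfolding g_def using int[OF ab] by (simp add: integrable_restrict_UNIV)
    then have "g integrable_on cbox c d" for c d
      using integrable_on_subcbox by blast
    then obtain N where N: "negligible N"
      and lim: "\<And>x e. x \<notin> N \<Longrightarrow> 0 < e \<Longrightarrow> \<exists>d>0. \<forall>h. 0 < h \<and> h < d \<longrightarrow>
        norm (integral (cbox x (x + h *\<^sub>R One)) g /\<^sub>R h ^ DIM('a) - g x) < e"
      using integrable_ccontinuous_explicit[of g] by metis
    have "f x = 0" if x: "x \<in> box a b" "x \<notin> N" for x
    proof (rule ccontr)
      assume "f x \<noteq> 0"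
      moreover have gx: "g x = f x"
        using x box_subset_cbox by (auto simp: g_def)
      \<comment> \<open>The tolerance is \<open>norm (f x)\<close> itself: an average equal to 0
        would then give \<open>norm (f x) < norm (f x)\<close>.\<close>
      ultimately obtain d where d: "d > 0"
        and less: "\<And>h. 0 < h \<Longrightarrow> h < d \<Longrightarrow>
          norm (integral (cbox x (x + h *\<^sub>R One)) g /\<^sub>R h ^ DIM('a) - f x) < norm (f x)"
        using lim[of x "norm (f x)"] x by auto
      have "((\<lambda>h. x + h *\<^sub>R One) \<longlongrightarrow> x + 0 *\<^sub>R One) (at_right 0)"
        by (intro tendsto_intros)
      then have "\<forall>\<^sub>F h in at_right 0. x + h *\<^sub>R One \<in> box a b"
        using x(1) by (intro topological_tendstoD) (auto simp: open_box)
      moreover have "\<forall>\<^sub>F h in at_right 0. 0 < h \<and> h < d"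
        using d by (auto simp: eventually_at_right_field)
      ultimately have "\<forall>\<^sub>F h in at_right 0. x + h *\<^sub>R One \<in> box a b \<and> 0 < h \<and> h < d"
        by eventually_elim auto
      then obtain h where h: "x + h *\<^sub>R One \<in> box a b" "0 < h" "h < d"
        using eventually_happens' trivial_limit_at_right_real by blast
      have sub: "cbox x (x + h *\<^sub>R One) \<subseteq> cbox a b"
        using x(1) h(1) by (intro subset_box_imp) (auto simp: mem_box intro: less_imp_le)
      then have "integral (cbox x (x + h *\<^sub>R One)) g = integral (cbox x (x + h *\<^sub>R One)) f"
        by (intro integral_cong) (auto simp: g_def)
      also have "\<dots> = 0"
        using sub ab by (intro zero) auto
      finally show False
        using less[OF h(2,3)] by simp
    qed
    \<comment> \<open>The argument covers the open box only, but the boundary of the box is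
      negligible.\<close>
    then have "{x \<in> cbox a b. f x \<noteq> 0} \<subseteq> N \<union> (cbox a b - box a b)"
      by auto
    then show ?thesis
      using N negligible_frontier_interval negligible_Un negligible_subset by metis
  qed
  \<comment> \<open>Countably many closed boxes exhaust \<Omega>, so the exceptional sets add up to
    a negligible set.\<close>
  obtain \<D> where \<D>: "countable \<D>" "\<D> \<subseteq> Pow \<Omega>" "\<And>X. X \<in> \<D> \<Longrightarrow> \<exists>a b. X = cbox a b" "\<Union>\<D> = \<Omega>"
    using open_countable_Union_open_cbox[OF \<open>open \<Omega>\<close>] by metis
  have "negligible (\<Union>((\<lambda>X. {x \<in> X. f x \<noteq> 0}) ` \<D>))"
  proof (rule negligible_countable_Union)
    show "countable ((\<lambda>X. {x \<in> X. f x \<noteq> 0}) ` \<D>)"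
      using \<D>(1) by simp
    fix Y assume "Y \<in> (\<lambda>X. {x \<in> X. f x \<noteq> 0}) ` \<D>"
    then obtain X where "X \<in> \<D>" "Y = {x \<in> X. f x \<noteq> 0}"
      by blast
    then show "negligible Y"
      using \<D>(2) \<D>(3)[of X] neg by auto
  qed
  moreover have "\<Union>((\<lambda>X. {x \<in> X. f x \<noteq> 0}) ` \<D>) = {x \<in> \<Omega>. f x \<noteq> 0}"
    using \<D>(4) by blast
  ultimately have "{x \<in> \<Omega>. f x \<noteq> 0} \<in> null_sets lebesgue"
    by (simp add: negligible_iff_null_sets)
  moreover have "\<Omega> \<in> sets lebesgue"
    using \<open>open \<Omega>\<close> by (simp add: borel_open)
  ultimately show ?thesis
    using AE_not_in[of "{x \<in> \<Omega>. f x \<noteq> 0}" lebesgue] by (simp add: AE_restrict_space_iff)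
qed

text \<open>Fundamental lemma of the calculus of variations. The cutoffs approximate the indicator
  of a box, and dominated convergence turns orthogonality into vanishing box integrals.\<close>

lemma AE_zero_if_orthogonal_to_tests:
  fixes g :: "'a::euclidean_space \<Rightarrow> 'b::euclidean_space"
  assumes "open \<Omega>" and g: "L2 \<Omega> g"
    and orth: "\<And>\<phi> D. C1_gradient \<phi> D \<Longrightarrow> compact_support_in \<Omega> \<phi> \<Longrightarrow>
      (LINT x|lebesgue_on \<Omega>. \<phi> x *\<^sub>R g x) = 0"
  shows "AE x in lebesgue_on \<Omega>. g x = 0"
proof -
  let ?M = "lebesgue_on \<Omega>"
  have \<Omega>: "\<Omega> \<in> sets lebesgue"
    using \<open>open \<Omega>\<close> by (simp add: borel_open)
  have g_meas [measurable]: "g \<in> borel_measurable ?M"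
    using g by (simp add: L2_def)
  have "g integrable_on cbox a b \<and> integral (cbox a b) g = 0" if ab: "cbox a b \<subseteq> \<Omega>" for a b
  proof -
    obtain \<phi> :: "nat \<Rightarrow> 'a \<Rightarrow> real" where \<phi>: "\<And>k. \<exists>D. C1_gradient (\<phi> k) D"
        "\<And>k x. 0 \<le> \<phi> k x" "\<And>k x. \<phi> k x \<le> 1" "\<And>k x. x \<notin> box a b \<Longrightarrow> \<phi> k x = 0"
        "\<And>x. (\<lambda>k. \<phi> k x) \<longlonglongrightarrow> indicator (box a b) x"
      using box_cutoff[of a b] by metis
    \<comment> \<open>The closed support may reach the boundary of the box; it stays in \<Omega>
      because the closed box does.\<close>
    have sub: "closure {x. \<phi> k x \<noteq> 0} \<subseteq> cbox a b" for k
      using \<phi>(4)[of _ k] box_subset_cbox[of a b] by (intro closure_minimal) auto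
    then have supp: "compact_support_in \<Omega> (\<phi> k)" for k
      unfolding compact_support_in_def
      using ab by (meson closed_closure compact_Int_closed compact_cbox compact_eq_bounded_closed
          bounded_cbox bounded_subset order_trans)
    have int0: "(LINT x|?M. \<phi> k x *\<^sub>R g x) = 0" for k
      using \<phi>(1)[of k] orth[OF _ supp] by blast
    have meas: "(\<lambda>x. \<phi> k x *\<^sub>R g x) \<in> borel_measurable ?M" for k
    proof -
      obtain D where "C1_gradient (\<phi> k) D"
        using \<phi>(1)[of k] by (elim exE)
      then show ?thesis
        by (intro borel_measurable_integrable L2_scaleR_integrable[OF _ g]
            test_function_L2(1)[OF \<open>open \<Omega>\<close> _ supp])
    qed
    have boxM: "box a b \<in> sets ?M" "cbox a b \<in> sets ?M"
      using ab box_subset_cbox[of a b] \<Omega> by (auto simp: sets_restrict_space_iff)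
    have "emeasure ?M (cbox a b) < \<infinity>"
      using ab \<Omega> emeasure_lborel_cbox_finite[of a b] by (simp add: emeasure_restrict_space less_top)
    then have "integrable ?M (indicator (cbox a b) :: 'a \<Rightarrow> real)"
      using boxM by (intro integrable_real_indicator) auto
    moreover have "(norm (indicator (cbox a b) x :: real))\<^sup>2 = indicator (cbox a b) x" for x
      by (simp add: indicator_def)
    ultimately have "L2 \<Omega> (indicator (cbox a b) :: 'a \<Rightarrow> real)"
      using boxM by (simp add: L2_def borel_measurable_indicator)
    \<comment> \<open>On a bounded box square integrability implies integrability; this is the
      dominating function.\<close>
    then have dom: "integrable ?M (\<lambda>x. norm (indicator (cbox a b) x *\<^sub>R g x))"
      by (intro integrable_norm L2_scaleR_integrable g)
    have dct: "integrable ?M (\<lambda>x. indicator (box a b) x *\<^sub>R g x) \<and>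
        (\<lambda>k. LINT x|?M. \<phi> k x *\<^sub>R g x) \<longlonglongrightarrow> (LINT x|?M. indicator (box a b) x *\<^sub>R g x)"
    proof (intro conjI)
      note lim = tendsto_scaleR[OF \<phi>(5) tendsto_const]
      have le: "norm (\<phi> k x *\<^sub>R g x) \<le> norm (indicator (cbox a b) x *\<^sub>R g x)" for k x
      proof (cases "x \<in> cbox a b")
        case True
        then show ?thesis
          using \<phi>(2,3)[of k x] by (simp add: mult_left_le_one_le)
      next
        case False
        then have "\<phi> k x = 0"
          using \<phi>(4) box_subset_cbox[of a b] by auto
        then show ?thesis
          by simp
      qed
      have meas': "(\<lambda>x. indicator (box a b) x *\<^sub>R g x) \<in> borel_measurable ?M"
        using boxM by (intro borel_measurable_scaleR borel_measurable_indicator g_meas)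
      show "integrable ?M (\<lambda>x. indicator (box a b) x *\<^sub>R g x)"
        by (rule integrable_dominated_convergence[OF meas' meas dom]) (rule AE_I2, rule lim, rule AE_I2, rule le)
      show "(\<lambda>k. LINT x|?M. \<phi> k x *\<^sub>R g x) \<longlonglongrightarrow> (LINT x|?M. indicator (box a b) x *\<^sub>R g x)"
        by (rule integral_dominated_convergence[OF meas' meas dom]) (rule AE_I2, rule lim, rule AE_I2, rule le)
    qed
    \<comment> \<open>By \<open>int0\<close> the convergent sequence of integrals is constantly
      0.\<close>
    then have zero: "(LINT x|?M. indicator (box a b) x *\<^sub>R g x) = 0"
      unfolding int0 using LIMSEQ_unique tendsto_const by blast
    have eq: "indicator \<Omega> x *\<^sub>R indicator (box a b) x *\<^sub>R g x = indicator (box a b) x *\<^sub>R g x" for x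
      using ab box_subset_cbox[of a b] by (auto simp: indicator_def)
    have "integrable lebesgue (\<lambda>x. indicator \<Omega> x *\<^sub>R indicator (box a b) x *\<^sub>R g x)"
      using dct \<Omega> by (subst integrable_restrict_space[symmetric]) auto
    then have "set_integrable lebesgue (box a b) g"
      unfolding set_integrable_def eq .
    from set_lebesgue_integral_eq_integral[OF this]
    have "g integrable_on box a b" "(LINT x|lebesgue. indicator (box a b) x *\<^sub>R g x) = integral (box a b) g"
      by (simp_all add: set_lebesgue_integral_def)
    moreover have "(LINT x|lebesgue. indicator (box a b) x *\<^sub>R g x) = 0"
      using zero \<Omega> by (simp add: integral_restrict_space eq del: scaleR_scaleR)
    ultimately show ?thesis
      by (simp add: integrable_on_open_interval integral_open_interval)
  qed
  then show ?thesis
    using AE_zero_if_box_integrals_zero[OF \<open>open \<Omega>\<close>] by blast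
qed

text \<open>Both gradients have the same pairing with every test function, so their difference is
  orthogonal to all of them. This makes the choice in \<open>wgrad\<close> harmless under
  integrals.\<close>

lemma is_weak_gradient_unique:
  assumes "open \<Omega>" "is_weak_gradient \<Omega> u G" "is_weak_gradient \<Omega> u H"
  shows "AE x in lebesgue_on \<Omega>. G x = H x"
proof -
  have G: "L2 \<Omega> G" and H: "L2 \<Omega> H"
    using assms by (auto simp: is_weak_gradient_def)
  have GH: "L2 \<Omega> (\<lambda>x. G x - H x)"
    using L2_lincomb[OF G H, of 1 "-1"] by simp
  have "AE x in lebesgue_on \<Omega>. G x - H x = 0"
  proof (rule AE_zero_if_orthogonal_to_tests[OF \<open>open \<Omega>\<close> GH])
    fix \<phi> D assume \<phi>: "C1_gradient \<phi> D" "compact_support_in \<Omega> \<phi>"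
    note L2 = test_function_L2(1)[OF \<open>open \<Omega>\<close> \<phi>]
    have "- (LINT x|lebesgue_on \<Omega>. \<phi> x *\<^sub>R G x) = - (LINT x|lebesgue_on \<Omega>. \<phi> x *\<^sub>R H x)"
    proof -
      have "(LINT x|lebesgue_on \<Omega>. u x *\<^sub>R D x) = - (LINT x|lebesgue_on \<Omega>. \<phi> x *\<^sub>R G x)"
        using assms(2) \<phi> by (simp add: is_weak_gradient_def)
      moreover have "(LINT x|lebesgue_on \<Omega>. u x *\<^sub>R D x) = - (LINT x|lebesgue_on \<Omega>. \<phi> x *\<^sub>R H x)"
        using assms(3) \<phi> by (simp add: is_weak_gradient_def)
      ultimately show ?thesis
        by simp
    qed
    then show "(LINT x|lebesgue_on \<Omega>. \<phi> x *\<^sub>R (G x - H x)) = 0"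
      by (simp add: scaleR_diff_right L2_scaleR_integrable[OF L2] G H)
  qed
  then show ?thesis
    by simp
qed

lemma is_weak_gradient_lincomb:
  assumes "open \<Omega>" and u: "L2 \<Omega> u" "is_weak_gradient \<Omega> u G" and v: "L2 \<Omega> v" "is_weak_gradient \<Omega> v H"
  shows "is_weak_gradient \<Omega> (\<lambda>x. a * u x + b * v x) (\<lambda>x. a *\<^sub>R G x + b *\<^sub>R H x)"
  unfolding is_weak_gradient_def
proof (intro conjI allI impI)
  have G: "L2 \<Omega> G" and H: "L2 \<Omega> H"
    using u v by (auto simp: is_weak_gradient_def)
  then show "L2 \<Omega> (\<lambda>x. a *\<^sub>R G x + b *\<^sub>R H x)"
    by (rule L2_lincomb)
  fix \<phi> D assume *: "C1_gradient \<phi> D \<and> compact_support_in \<Omega> \<phi>"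
  then have \<phi>: "L2 \<Omega> \<phi>" "L2 \<Omega> D"
    using test_function_L2[OF \<open>open \<Omega>\<close>] by auto
  have "(LINT x|lebesgue_on \<Omega>. (a * u x + b * v x) *\<^sub>R D x)
      = (LINT x|lebesgue_on \<Omega>. a *\<^sub>R (u x *\<^sub>R D x) + b *\<^sub>R (v x *\<^sub>R D x))"
    by (simp add: scaleR_left_distrib)
  also have "\<dots> = a *\<^sub>R (LINT x|lebesgue_on \<Omega>. u x *\<^sub>R D x) + b *\<^sub>R (LINT x|lebesgue_on \<Omega>. v x *\<^sub>R D x)"
    by (subst Bochner_Integration.integral_add)
      (auto intro!: integrable_scaleR_right L2_scaleR_integrable u v \<phi> simp del: scaleR_scaleR)
  also have "\<dots> = - (a *\<^sub>R (LINT x|lebesgue_on \<Omega>. \<phi> x *\<^sub>R G x) + b *\<^sub>R (LINT x|lebesgue_on \<Omega>. \<phi> x *\<^sub>R H x))"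
    using u(2) v(2) * by (simp add: is_weak_gradient_def)
  also have "a *\<^sub>R (LINT x|lebesgue_on \<Omega>. \<phi> x *\<^sub>R G x) + b *\<^sub>R (LINT x|lebesgue_on \<Omega>. \<phi> x *\<^sub>R H x)
      = (LINT x|lebesgue_on \<Omega>. a *\<^sub>R (\<phi> x *\<^sub>R G x) + b *\<^sub>R (\<phi> x *\<^sub>R H x))"
    by (subst Bochner_Integration.integral_add)
      (auto intro!: integrable_scaleR_right L2_scaleR_integrable G H \<phi> simp del: scaleR_scaleR)
  also have "\<dots> = (LINT x|lebesgue_on \<Omega>. \<phi> x *\<^sub>R (a *\<^sub>R G x + b *\<^sub>R H x))"
    by (simp add: scaleR_right_distrib mult.commute)
  finally show "(LINT x|lebesgue_on \<Omega>. (a * u x + b * v x) *\<^sub>R D x)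
      = - (LINT x|lebesgue_on \<Omega>. \<phi> x *\<^sub>R (a *\<^sub>R G x + b *\<^sub>R H x))" .
qed

section \<open>The chosen weak gradient on \<open>H1\<close>\<close>

lemma is_weak_gradient_wgrad: "u \<in> H1 \<Omega> \<Longrightarrow> is_weak_gradient \<Omega> u (wgrad \<Omega> u)"
  unfolding H1_def wgrad_def using someI_ex[of "is_weak_gradient \<Omega> u"] by simp

lemma H1_L2:
  assumes "u \<in> H1 \<Omega>" shows "L2 \<Omega> u" "L2 \<Omega> (wgrad \<Omega> u)"
  using assms is_weak_gradient_wgrad[OF assms] by (auto simp: H1_def is_weak_gradient_def)

text \<open>Linearity is only almost everywhere because \<open>wgrad\<close> picks a representative
  separately for each function.\<close>

lemma H1_lincomb:
  assumes "open \<Omega>" "u \<in> H1 \<Omega>" "v \<in> H1 \<Omega>"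
  shows "(\<lambda>x. a * u x + b * v x) \<in> H1 \<Omega>"
    and "AE x in lebesgue_on \<Omega>. wgrad \<Omega> (\<lambda>x. a * u x + b * v x) x = a *\<^sub>R wgrad \<Omega> u x + b *\<^sub>R wgrad \<Omega> v x"
proof -
  have *: "is_weak_gradient \<Omega> (\<lambda>x. a * u x + b * v x) (\<lambda>x. a *\<^sub>R wgrad \<Omega> u x + b *\<^sub>R wgrad \<Omega> v x)"
    using assms by (intro is_weak_gradient_lincomb is_weak_gradient_wgrad H1_L2)
  have "L2 \<Omega> (\<lambda>x. a * u x + b * v x)"
    using L2_lincomb[OF H1_L2(1)[OF assms(2)] H1_L2(1)[OF assms(3)], of a b] by simp
  with * show mem: "(\<lambda>x. a * u x + b * v x) \<in> H1 \<Omega>"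
    by (auto simp: H1_def)
  show "AE x in lebesgue_on \<Omega>. wgrad \<Omega> (\<lambda>x. a * u x + b * v x) x = a *\<^sub>R wgrad \<Omega> u x + b *\<^sub>R wgrad \<Omega> v x"
    using is_weak_gradient_unique[OF assms(1) is_weak_gradient_wgrad[OF mem] *] .
qed

section \<open>Convexity of the admissible class\<close>

lemma norm_sq_convex:
  fixes x y :: "'b::real_inner"
  assumes "0 \<le> t" "t \<le> 1"
  shows "(norm ((1 - t) *\<^sub>R x + t *\<^sub>R y))\<^sup>2 \<le> (1 - t) * (norm x)\<^sup>2 + t * (norm y)\<^sup>2"
proof -
  \<comment> \<open>In an inner product space the convexity defect is an explicit square.\<close>
  have "(1 - t) * (norm x)\<^sup>2 + t * (norm y)\<^sup>2 - (norm ((1 - t) *\<^sub>R x + t *\<^sub>R y))\<^sup>2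
      = t * (1 - t) * (norm (x - y))\<^sup>2"
    by (simp add: power2_norm_eq_inner inner_simps inner_commute algebra_simps)
  moreover have "t * (1 - t) * (norm (x - y))\<^sup>2 \<ge> 0"
    using assms by simp
  ultimately show ?thesis
    by linarith
qed

lemma H1_norm_sq_integrable:
  assumes "u \<in> H1 \<Omega>"
  shows "integrable (lebesgue_on \<Omega>) (\<lambda>x. (u x)\<^sup>2 + (norm (wgrad \<Omega> u x))\<^sup>2)"
  using H1_L2[OF assms] by (auto simp: L2_def)

lemma H1_norm_sq: "(H1_norm \<Omega> u)\<^sup>2 = (LINT x|lebesgue_on \<Omega>. (u x)\<^sup>2 + (norm (wgrad \<Omega> u x))\<^sup>2)"
  unfolding H1_norm_def by (intro real_sqrt_pow2 integral_nonneg_AE) auto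

lemma H1_norm_nonneg: "H1_norm \<Omega> u \<ge> 0"
  unfolding H1_norm_def by (intro real_sqrt_ge_zero integral_nonneg_AE) auto

text \<open>Stands in for the triangle inequality: convexity of the squared norm is enough to pass
  to limits of convex combinations.\<close>

lemma H1_norm_sq_convex:
  assumes "open \<Omega>" and u: "u \<in> H1 \<Omega>" and v: "v \<in> H1 \<Omega>" and t: "0 \<le> t" "t \<le> 1"
  shows "(H1_norm \<Omega> (\<lambda>x. (1 - t) * u x + t * v x))\<^sup>2 \<le> (1 - t) * (H1_norm \<Omega> u)\<^sup>2 + t * (H1_norm \<Omega> v)\<^sup>2"
proof -
  let ?M = "lebesgue_on \<Omega>" and ?z = "\<lambda>x. (1 - t) * u x + t * v x"
  note z = H1_lincomb[OF \<open>open \<Omega>\<close> u v, of "1 - t" t]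
  have "(H1_norm \<Omega> ?z)\<^sup>2 \<le> (LINT x|?M. (1 - t) * ((u x)\<^sup>2 + (norm (wgrad \<Omega> u x))\<^sup>2)
      + t * ((v x)\<^sup>2 + (norm (wgrad \<Omega> v x))\<^sup>2))"
    unfolding H1_norm_sq
  proof (rule integral_mono_AE)
    show "integrable ?M (\<lambda>x. (?z x)\<^sup>2 + (norm (wgrad \<Omega> ?z x))\<^sup>2)"
      by (rule H1_norm_sq_integrable[OF z(1)])
    show "integrable ?M (\<lambda>x. (1 - t) * ((u x)\<^sup>2 + (norm (wgrad \<Omega> u x))\<^sup>2)
        + t * ((v x)\<^sup>2 + (norm (wgrad \<Omega> v x))\<^sup>2))"
      by (intro Bochner_Integration.integrable_add integrable_mult_right H1_norm_sq_integrable u v)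
    show "AE x in ?M. (?z x)\<^sup>2 + (norm (wgrad \<Omega> ?z x))\<^sup>2 \<le>
        (1 - t) * ((u x)\<^sup>2 + (norm (wgrad \<Omega> u x))\<^sup>2) + t * ((v x)\<^sup>2 + (norm (wgrad \<Omega> v x))\<^sup>2)"
      using z(2)
    proof eventually_elim
      case (elim x)
      have "(?z x)\<^sup>2 \<le> (1 - t) * (u x)\<^sup>2 + t * (v x)\<^sup>2"
        using norm_sq_convex[OF t, of "u x" "v x"] by simp
      moreover have "(norm (wgrad \<Omega> ?z x))\<^sup>2 \<le> (1 - t) * (norm (wgrad \<Omega> u x))\<^sup>2 + t * (norm (wgrad \<Omega> v x))\<^sup>2"
        using norm_sq_convex[OF t] elim by simp
      ultimately show ?case
        unfolding distrib_left by linarith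
    qed
  qed
  also have "\<dots> = (1 - t) * (H1_norm \<Omega> u)\<^sup>2 + t * (H1_norm \<Omega> v)\<^sup>2"
    unfolding H1_norm_sq
    by (subst Bochner_Integration.integral_add)
      (intro integrable_mult_right H1_norm_sq_integrable u v | simp)+
  finally show ?thesis .
qed

lemma H1_closure_convex:
  assumes "open \<Omega>"
    and S: "\<And>\<phi> \<psi>. \<phi> \<in> S \<Longrightarrow> \<psi> \<in> S \<Longrightarrow> (\<lambda>x. (1 - t) * \<phi> x + t * \<psi> x) \<in> S"
    and u: "u \<in> H1_closure \<Omega> S" and v: "v \<in> H1_closure \<Omega> S" and t: "0 \<le> t" "t \<le> 1"
  shows "(\<lambda>x. (1 - t) * u x + t * v x) \<in> H1_closure \<Omega> S"
proof -
  obtain \<phi> where \<phi>: "\<And>k::nat. \<phi> k \<in> S \<inter> H1 \<Omega>" "(\<lambda>k. H1_norm \<Omega> (\<lambda>x. u x - \<phi> k x)) \<longlonglongrightarrow> 0"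
    using u unfolding H1_closure_def by blast
  obtain \<psi> where \<psi>: "\<And>k::nat. \<psi> k \<in> S \<inter> H1 \<Omega>" "(\<lambda>k. H1_norm \<Omega> (\<lambda>x. v x - \<psi> k x)) \<longlonglongrightarrow> 0"
    using v unfolding H1_closure_def by blast
  have uv: "u \<in> H1 \<Omega>" "v \<in> H1 \<Omega>"
    using u v by (auto simp: H1_closure_def)
  define \<zeta> where "\<zeta> k x = (1 - t) * \<phi> k x + t * \<psi> k x" for k x
  let ?z = "\<lambda>x. (1 - t) * u x + t * v x"
  let ?d = "\<lambda>k. H1_norm \<Omega> (\<lambda>x. ?z x - \<zeta> k x)"
  have diff: "(\<lambda>x. f x - g x) \<in> H1 \<Omega>" if "f \<in> H1 \<Omega>" "g \<in> H1 \<Omega>" for f g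
    using H1_lincomb(1)[OF \<open>open \<Omega>\<close> that, of 1 "-1"] by simp
  \<comment> \<open>The approximants are mixed with the same weights as the limits, so the error is
    the same mixture of the two errors.\<close>
  have le: "(?d k)\<^sup>2 \<le> (1 - t) * (H1_norm \<Omega> (\<lambda>x. u x - \<phi> k x))\<^sup>2 + t * (H1_norm \<Omega> (\<lambda>x. v x - \<psi> k x))\<^sup>2" for k
  proof -
    have "(\<lambda>x. ?z x - \<zeta> k x) = (\<lambda>x. (1 - t) * (u x - \<phi> k x) + t * (v x - \<psi> k x))"
      by (auto simp: \<zeta>_def algebra_simps)
    moreover have "(\<lambda>x. u x - \<phi> k x) \<in> H1 \<Omega>" "(\<lambda>x. v x - \<psi> k x) \<in> H1 \<Omega>"
      using diff uv \<phi>(1)[of k] \<psi>(1)[of k] by auto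
    ultimately show ?thesis
      using H1_norm_sq_convex[OF \<open>open \<Omega>\<close> _ _ t] by simp
  qed
  have "(\<lambda>k. (1 - t) * (H1_norm \<Omega> (\<lambda>x. u x - \<phi> k x))\<^sup>2 + t * (H1_norm \<Omega> (\<lambda>x. v x - \<psi> k x))\<^sup>2)
      \<longlonglongrightarrow> (1 - t) * 0\<^sup>2 + t * 0\<^sup>2"
    by (intro tendsto_intros \<phi> \<psi>)
  then have lim: "(\<lambda>k. (1 - t) * (H1_norm \<Omega> (\<lambda>x. u x - \<phi> k x))\<^sup>2
      + t * (H1_norm \<Omega> (\<lambda>x. v x - \<psi> k x))\<^sup>2) \<longlonglongrightarrow> 0"
    by simp
  have "(\<lambda>k. (?d k)\<^sup>2) \<longlonglongrightarrow> 0"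
    by (rule tendsto_sandwich[OF _ _ tendsto_const lim]; rule always_eventually; rule allI)
      (rule zero_le_power2, rule le)
  then have "(\<lambda>k. sqrt ((?d k)\<^sup>2)) \<longlonglongrightarrow> sqrt 0"
    by (rule tendsto_real_sqrt)
  then have "?d \<longlonglongrightarrow> 0"
    by (simp add: H1_norm_nonneg)
  moreover have "\<zeta> k \<in> S \<inter> H1 \<Omega>" for k
    using S \<phi>(1)[of k] \<psi>(1)[of k] H1_lincomb(1)[OF \<open>open \<Omega>\<close>] unfolding \<zeta>_def by auto
  moreover have "?z \<in> H1 \<Omega>"
    using uv by (intro H1_lincomb(1)[OF \<open>open \<Omega>\<close>])
  ultimately show ?thesis
    unfolding H1_closure_def by blast
qed

lemma C1_gradient_lincomb:
  assumes "C1_gradient f D" "C1_gradient g E"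
  shows "C1_gradient (\<lambda>x. a * f x + b * g x) (\<lambda>x. a *\<^sub>R D x + b *\<^sub>R E x)"
proof -
  \<comment> \<open>The zero terms come from treating the scalar factors as constant functions in
    the product rule.\<close>
  have "GDERIV (\<lambda>x. a * f x + b * g x) x :> (a *\<^sub>R D x + f x *\<^sub>R 0) + (b *\<^sub>R E x + g x *\<^sub>R 0)" for x
    using assms by (intro GDERIV_add GDERIV_mult GDERIV_const) (auto simp: C1_gradient_def)
  then show ?thesis
    using assms by (auto simp: C1_gradient_def intro!: continuous_on_add continuous_on_scaleR continuous_on_const)
qed

lemma admissible_subset_H1: "admissible \<Omega> bc \<subseteq> H1 \<Omega>"
  by (cases bc) (auto simp: H1_closure_def)

text \<open>Convex weights sum to 1, which preserves the Dirichlet values 1 and -1 of the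
  approximating functions.\<close>

lemma admissible_convex:
  assumes "open \<Omega>" "u \<in> admissible \<Omega> bc" "v \<in> admissible \<Omega> bc" "0 \<le> t" "t \<le> 1"
  shows "(\<lambda>x. (1 - t) * u x + t * v x) \<in> admissible \<Omega> bc"
proof (cases bc)
  case (Dirichlet \<Gamma>)
  then show ?thesis
    using assms(2-5) unfolding Dirichlet admissible.simps
    by (intro H1_closure_convex[OF assms(1)]) (auto intro: C1_gradient_lincomb)
next
  case Neumann
  then show ?thesis
    using assms H1_lincomb(1) by simp
next
  case (Periodic a b)
  then show ?thesis
    using assms(2-5) unfolding Periodic admissible.simps
    by (intro H1_closure_convex[OF assms(1)]) (auto simp: periodic_C1_def intro: C1_gradient_lincomb)
qed

section \<open>Directional derivatives of convex integral functionals\<close>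

text \<open>The modulus of \<open>f\<close> is at most that of \<open>g\<close> plus the negative
  part of \<open>f\<close>. This fits functionals with values in (-\<infinity>, \<infinity>], where
  finiteness of the negative part is given.\<close>

lemma integrable_if_bounded_above:
  fixes f g :: "'a \<Rightarrow> real"
  assumes f [measurable]: "f \<in> borel_measurable M" and g: "integrable M g"
    and le: "\<And>x. f x \<le> g x" and neg: "(\<integral>\<^sup>+x. ennreal (- f x) \<partial>M) < \<infinity>"
  shows "integrable M f"
proof (rule integrableI_bounded[OF f])
  have "(\<integral>\<^sup>+x. norm (f x) \<partial>M) \<le> (\<integral>\<^sup>+x. ennreal (norm (g x)) + ennreal (- f x) \<partial>M)"
  proof (rule nn_integral_mono)
    fix x
    show "ennreal (norm (f x)) \<le> ennreal (norm (g x)) + ennreal (- f x)"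
      using le[of x]
      by (cases "f x \<ge> 0") (auto simp: ennreal_neg intro!: ennreal_leI order_trans[OF ennreal_leI add_increasing])
  qed
  also have "\<dots> = (\<integral>\<^sup>+x. ennreal (norm (g x)) \<partial>M) + (\<integral>\<^sup>+x. ennreal (- f x) \<partial>M)"
    using g by (intro nn_integral_add) auto
  also have "\<dots> < \<infinity>"
    using neg g by (auto simp: integrable_iff_bounded)
  finally show "(\<integral>\<^sup>+x. norm (f x) \<partial>M) < \<infinity>" .
qed

text \<open>Convexity bounds the difference quotients \<open>q k\<close> only from above, by
  \<open>H\<close>, so Fatou's lemma is applied to the nonnegative functions \<open>H - q k\<close>.
  Minimality at 0 makes the integrals of \<open>q k\<close> nonnegative, which bounds those of
  \<open>H - q k\<close> by that of \<open>H\<close>.\<close>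

lemma integral_directional_derivative_nonneg:
  fixes F :: "real \<Rightarrow> 'a \<Rightarrow> real"
  assumes F0: "integrable M (F 0)" and F1: "integrable M (F 1)"
    and F: "\<And>t. 0 < t \<Longrightarrow> t < 1 \<Longrightarrow> integrable M (F t)"
    and min: "\<And>t. 0 < t \<Longrightarrow> t < 1 \<Longrightarrow> integral\<^sup>L M (F 0) \<le> integral\<^sup>L M (F t)"
    and conv: "\<And>t x. 0 < t \<Longrightarrow> t < 1 \<Longrightarrow> F t x \<le> (1 - t) * F 0 x + t * F 1 x"
    and D: "\<And>x. ((\<lambda>t. F t x) has_real_derivative D x) (at 0)"
  shows "integrable M D" "0 \<le> integral\<^sup>L M D"
proof -
  \<comment> \<open>The shift by 2 keeps every term strictly below 1, also for
    \<open>k = 0\<close>.\<close>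
  define t where "t k = 1 / (real k + 2)" for k
  have t: "0 < t k" "t k < 1" for k
    by (auto simp: t_def field_simps)
  define q where "q k x = (F (t k) x - F 0 x) / t k" for k x
  define H where "H x = F 1 x - F 0 x" for x
  have q: "integrable M (q k)" for k
    unfolding q_def using F[OF t] F0 by (intro integrable_divide Bochner_Integration.integrable_diff)
  have H: "integrable M H"
    unfolding H_def using F1 F0 by (intro Bochner_Integration.integrable_diff)
  have q_nonneg: "0 \<le> integral\<^sup>L M (q k)" for k
    unfolding q_def using F[OF t] F0 min[OF t] t(1)[of k] by simp
  have qH: "q k x \<le> H x" for k x
    using conv[OF t[of k], of x] t(1)[of k] by (simp add: q_def H_def field_simps)
  have "t \<longlonglongrightarrow> 0"
    unfolding t_def by real_asymp
  then have "filterlim t (at 0) sequentially"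
    using t(1) by (auto simp: filterlim_at less_imp_neq[symmetric])
  then have lim: "(\<lambda>k. q k x) \<longlonglongrightarrow> D x" for x
    using filterlim_compose[OF D[of x, unfolded DERIV_def]] by (simp add: q_def)
  have D_meas: "D \<in> borel_measurable M"
    using lim by (rule borel_measurable_LIMSEQ_real) (use q in blast)
  have DH: "D x \<le> H x" for x
    using LIMSEQ_le_const2[OF lim] qH by blast
  have "(\<integral>\<^sup>+x. ennreal (H x - D x) \<partial>M) = (\<integral>\<^sup>+x. liminf (\<lambda>k. ennreal (H x - q k x)) \<partial>M)"
    by (intro nn_integral_cong lim_imp_Liminf[symmetric] tendsto_ennrealI tendsto_diff lim) auto
  also have "\<dots> \<le> liminf (\<lambda>k. \<integral>\<^sup>+x. ennreal (H x - q k x) \<partial>M)"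
    using H q by (intro nn_integral_liminf) auto
  also have "\<dots> \<le> liminf (\<lambda>k::nat. ennreal (integral\<^sup>L M H))"
  proof (intro Liminf_mono always_eventually allI)
    fix k
    have "(\<integral>\<^sup>+x. ennreal (H x - q k x) \<partial>M) = ennreal (integral\<^sup>L M (\<lambda>x. H x - q k x))"
      using H q qH by (intro nn_integral_eq_integral) auto
    also have "\<dots> \<le> ennreal (integral\<^sup>L M H)"
      using H q q_nonneg[of k] by (intro ennreal_leI) simp
    finally show "(\<integral>\<^sup>+x. ennreal (H x - q k x) \<partial>M) \<le> ennreal (integral\<^sup>L M H)" .
  qed
  finally have fatou: "(\<integral>\<^sup>+x. ennreal (H x - D x) \<partial>M) \<le> ennreal (integral\<^sup>L M H)"
    by (simp add: Liminf_const)
  have HD: "integrable M (\<lambda>x. H x - D x)"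
    using H D_meas DH fatou by (intro integrableI_nonneg) (auto intro: le_less_trans)
  from Bochner_Integration.integrable_diff[OF H HD] show intD: "integrable M D"
    by simp
  \<comment> \<open>Needed to pass from \<open>ennreal\<close> back to real numbers, since
    \<open>ennreal\<close> truncates negative values to 0.\<close>
  have "0 \<le> integral\<^sup>L M H"
    using order_trans[OF q_nonneg integral_mono[OF q H qH]] .
  moreover have "ennreal (integral\<^sup>L M (\<lambda>x. H x - D x)) \<le> ennreal (integral\<^sup>L M H)"
    using fatou nn_integral_eq_integral[OF HD] DH by simp
  ultimately have "integral\<^sup>L M (\<lambda>x. H x - D x) \<le> integral\<^sup>L M H"
    by simp
  then show "0 \<le> integral\<^sup>L M D"
    using H intD by simp
qed

section \<open>Energy dissipation\<close>

lemma C1_differentiable_on_UNIV_real: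
  fixes f :: "real \<Rightarrow> real"
  assumes "f C1_differentiable_on UNIV"
  shows "(f has_real_derivative deriv f s) (at s)" "continuous_on UNIV (deriv f)"
proof -
  obtain D where D: "\<And>x. (f has_vector_derivative D x) (at x)" "continuous_on UNIV D"
    using assms by (auto simp: C1_differentiable_on_def)
  have "(f has_real_derivative D x) (at x)" for x
    using D(1) by (simp add: has_real_derivative_iff_has_vector_derivative)
  moreover from this have "deriv f = D"
    by (auto intro: DERIV_imp_deriv)
  ultimately show "(f has_real_derivative deriv f s) (at s)" "continuous_on UNIV (deriv f)"
    using D(2) by auto
qed

locale convex_concave_splitting =
  fixes W Wvex Wconc :: "real \<Rightarrow> real" and c p :: real
  assumes W_nonneg: "W s \<ge> 0"
    and splitting: "W s = Wvex s + Wconc s"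
    and convex: "convex_on UNIV Wvex"
    and concave: "concave_on UNIV Wconc"
    and Wvex_C1: "Wvex C1_differentiable_on UNIV"
    and Wconc_C1: "Wconc C1_differentiable_on UNIV"
    and c_pos: "c > 0"
    and curvature: "W s \<ge> W S + (deriv Wvex S + deriv Wconc s) * (s - S) + c * \<bar>s - S\<bar> powr p"
begin

lemmas Wvex_deriv = C1_differentiable_on_UNIV_real(1)[OF Wvex_C1]
lemmas Wconc_deriv = C1_differentiable_on_UNIV_real(1)[OF Wconc_C1]

lemma W_measurable [measurable]:
  "Wvex \<in> borel_measurable borel" "Wconc \<in> borel_measurable borel" "W \<in> borel_measurable borel"
  "deriv Wconc \<in> borel_measurable borel"
proof -
  show 1: "Wvex \<in> borel_measurable borel"
    by (intro borel_measurable_continuous_onI continuous_at_imp_continuous_on ballI DERIV_isCont[OF Wvex_deriv])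
  show 2: "Wconc \<in> borel_measurable borel"
    by (intro borel_measurable_continuous_onI continuous_at_imp_continuous_on ballI DERIV_isCont[OF Wconc_deriv])
  have "W = (\<lambda>s. Wvex s + Wconc s)"
    using splitting by auto
  with 1 2 show "W \<in> borel_measurable borel"
    by simp
  show "deriv Wconc \<in> borel_measurable borel"
    using C1_differentiable_on_UNIV_real(2)[OF Wconc_C1] by (rule borel_measurable_continuous_onI)
qed

text \<open>Compares the linearized concave term of the step functional with \<open>Wconc\<close>
  itself; it is the tangent inequality for the convex function -\<open>Wconc\<close>.\<close>

lemma Wconc_below_tangent: "Wconc s \<le> Wconc S + deriv Wconc S * (s - S)"
proof -
  have "((\<lambda>x. - Wconc x) has_real_derivative - deriv Wconc S) (at S)"
    by (intro DERIV_minus Wconc_deriv)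
  then have "- Wconc s - - Wconc S \<ge> - deriv Wconc S * (s - S)"
    using concave unfolding concave_on_def
    by (intro convex_on_imp_above_tangent[where A = UNIV]) auto
  then show ?thesis
    by simp
qed

lemma step_integrand_measurable:
  assumes "w \<in> H1 \<Omega>" "v \<in> H1 \<Omega>"
  shows "step_integrand \<Omega> \<epsilon> \<tau> Wvex Wconc w v \<in> borel_measurable (lebesgue_on \<Omega>)"
proof -
  have [measurable]: "v \<in> borel_measurable (lebesgue_on \<Omega>)" "w \<in> borel_measurable (lebesgue_on \<Omega>)"
      "wgrad \<Omega> v \<in> borel_measurable (lebesgue_on \<Omega>)"
    using H1_L2[OF assms(1)] H1_L2[OF assms(2)] by (auto simp: L2_def)
  show ?thesis
    unfolding step_integrand_def[abs_def] by measurable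
qed

lemma step_minimizer_energy_decrease:
  assumes "open \<Omega>" and pos: "\<epsilon> > 0" "\<tau> > 0"
    and w: "w \<in> admissible \<Omega> bc" and v: "v \<in> admissible \<Omega> bc"
    and min: "step_minimizer \<Omega> bc \<epsilon> \<tau> Wvex Wconc w v"
    and fin: "energy \<Omega> \<epsilon> W w < \<infinity>"
  shows "energy \<Omega> \<epsilon> W v + ennreal (c / \<epsilon>) * (\<integral>\<^sup>+x. ennreal (\<bar>v x - w x\<bar> powr p) \<partial>lebesgue_on \<Omega>)
    \<le> energy \<Omega> \<epsilon> W w"
proof -
  let ?M = "lebesgue_on \<Omega>"
  define J where "J = step_integrand \<Omega> \<epsilon> \<tau> Wvex Wconc w"
  define a where "a = wgrad \<Omega> v"
  define b where "b = wgrad \<Omega> w"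
  define k where "k x = deriv Wconc (w x)" for x
  define e where "e z x = \<epsilon> / 2 * (norm (wgrad \<Omega> z x))\<^sup>2 + W (z x) / \<epsilon>" for z x
  \<comment> \<open>The step integrand on the segment from \<open>v\<close> to \<open>w\<close>,
    with the linear combination of the two gradients in place of the chosen gradient. This makes
    convexity and differentiability in \<open>t\<close> hold at every \<open>x\<close>.\<close>
  define F where "F t x = \<epsilon> / 2 * (norm ((1 - t) *\<^sub>R a x + t *\<^sub>R b x))\<^sup>2
      + (Wvex ((1 - t) * v x + t * w x) + k x * ((1 - t) * v x + t * w x)) / \<epsilon>
      + \<epsilon> / (2 * \<tau>) * (((1 - t) * v x + t * w x) - w x)\<^sup>2" for t x
  define D where "D x = \<epsilon> * (a x \<bullet> (b x - a x)) + (deriv Wvex (v x) + k x) * (w x - v x) / \<epsilon>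
      - \<epsilon> / \<tau> * (w x - v x)\<^sup>2" for x
  have H1: "v \<in> H1 \<Omega>" "w \<in> H1 \<Omega>"
    using v w admissible_subset_H1 by auto
  have meas [measurable]: "v \<in> borel_measurable ?M" "w \<in> borel_measurable ?M"
      "a \<in> borel_measurable ?M" "b \<in> borel_measurable ?M"
      "wgrad \<Omega> v \<in> borel_measurable ?M" "wgrad \<Omega> w \<in> borel_measurable ?M"
    using H1_L2[OF H1(1)] H1_L2[OF H1(2)] by (auto simp: L2_def a_def b_def)
  have k_meas [measurable]: "k \<in> borel_measurable ?M"
    unfolding k_def by measurable
  have F_meas: "F t \<in> borel_measurable ?M" for t
    unfolding F_def by measurable
  have e_meas [measurable]: "e v \<in> borel_measurable ?M" "e w \<in> borel_measurable ?M"
    unfolding e_def by measurable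
  have e_nonneg: "e z x \<ge> 0" for z x
    using pos W_nonneg by (simp add: e_def)
  have energy_eq: "energy \<Omega> \<epsilon> W z = (\<integral>\<^sup>+x. ennreal (e z x) \<partial>?M)" for z
    by (simp add: energy_def e_def)
  have ew: "integrable ?M (e w)"
    using fin e_nonneg e_meas unfolding energy_eq by (intro integrableI_nonneg) auto
  have Jv: "integrable ?M (J v)"
    and J_neg: "\<And>z. z \<in> admissible \<Omega> bc \<Longrightarrow> (\<integral>\<^sup>+x. ennreal (- J z x) \<partial>?M) < \<infinity>"
    and J_min: "\<And>z. z \<in> admissible \<Omega> bc \<Longrightarrow> integrable ?M (J z) \<Longrightarrow> (LINT x|?M. J v x) \<le> (LINT x|?M. J z x)"
    using min by (auto simp: step_minimizer_def J_def Let_def)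
  have F0: "F 0 = J v" and F1: "F 1 = J w"
    by (auto simp: F_def J_def step_integrand_def a_def b_def k_def)
  \<comment> \<open>At \<open>w\<close> the quadratic term vanishes and the gradient term is part of
    \<open>e w\<close>. Concavity and \<open>W (v x) \<ge> 0\<close> handle the potential; the
    gradient and quadratic terms of \<open>J v\<close> are nonnegative.\<close>
  have Jw_le: "J w x \<le> J v x + e w x" for x
  proof -
    have "(Wvex (w x) + k x * w x) \<le> (Wvex (v x) + k x * v x) + W (w x)"
      using Wconc_below_tangent[of "v x" "w x"] W_nonneg[of "v x"] splitting[of "v x"] splitting[of "w x"]
      by (simp add: k_def algebra_simps)
    then have "(Wvex (w x) + k x * w x) / \<epsilon> \<le> (Wvex (v x) + k x * v x) / \<epsilon> + W (w x) / \<epsilon>"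
      using pos by (simp add: divide_right_mono flip: add_divide_distrib)
    moreover have "\<epsilon> / 2 * (norm (a x))\<^sup>2 \<ge> 0" "\<epsilon> / (2 * \<tau>) * (v x - w x)\<^sup>2 \<ge> 0"
      using pos by auto
    ultimately show ?thesis
      by (simp add: J_def step_integrand_def e_def a_def k_def)
  qed
  have Jw: "integrable ?M (J w)"
  proof (rule integrable_if_bounded_above)
    show "J w \<in> borel_measurable ?M"
      unfolding J_def by (rule step_integrand_measurable[OF H1(2) H1(2)])
    show "integrable ?M (\<lambda>x. J v x + e w x)"
      using Jv ew by (rule Bochner_Integration.integrable_add)
  qed (rule Jw_le, rule J_neg[OF w])
  have conv: "F t x \<le> (1 - t) * F 0 x + t * F 1 x" if t: "0 < t" "t < 1" for t x
  proof -
    have t': "0 \<le> t" "t \<le> 1"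
      using t by auto
    have "\<epsilon> / 2 * (norm ((1 - t) *\<^sub>R a x + t *\<^sub>R b x))\<^sup>2
        \<le> \<epsilon> / 2 * ((1 - t) * (norm (a x))\<^sup>2 + t * (norm (b x))\<^sup>2)"
      using pos by (intro mult_left_mono norm_sq_convex t') auto
    moreover have "(Wvex ((1 - t) * v x + t * w x) + k x * ((1 - t) * v x + t * w x)) / \<epsilon>
        \<le> ((1 - t) * (Wvex (v x) + k x * v x) + t * (Wvex (w x) + k x * w x)) / \<epsilon>"
      using convex_onD[OF convex t', of "v x" "w x"] pos
      by (intro divide_right_mono) (auto simp: algebra_simps)
    \<comment> \<open>The deviation from \<open>w\<close> is a convex combination of
      \<open>v x - w x\<close> and 0.\<close>
    moreover have "\<epsilon> / (2 * \<tau>) * (((1 - t) * v x + t * w x) - w x)\<^sup>2 \<le> \<epsilon> / (2 * \<tau>) * ((1 - t) * (v x - w x)\<^sup>2)"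
    proof (rule mult_left_mono)
      have "((1 - t) * v x + t * w x) - w x = (1 - t) *\<^sub>R (v x - w x) + t *\<^sub>R 0"
        by (simp add: algebra_simps)
      then show "(((1 - t) * v x + t * w x) - w x)\<^sup>2 \<le> (1 - t) * (v x - w x)\<^sup>2"
        using norm_sq_convex[OF t', of "v x - w x" 0] by simp
    qed (use pos in simp)
    moreover have "(1 - t) * F 0 x + t * F 1 x = \<epsilon> / 2 * ((1 - t) * (norm (a x))\<^sup>2 + t * (norm (b x))\<^sup>2)
        + ((1 - t) * (Wvex (v x) + k x * v x) + t * (Wvex (w x) + k x * w x)) / \<epsilon>
        + \<epsilon> / (2 * \<tau>) * ((1 - t) * (v x - w x)\<^sup>2)"
      unfolding F_def by (simp add: add_divide_distrib distrib_left mult.left_commute)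
    ultimately show ?thesis
      unfolding F_def by linarith
  qed
  have F_int: "integrable ?M (F t) \<and> (LINT x|?M. F 0 x) \<le> (LINT x|?M. F t x)" if t: "0 < t" "t < 1" for t
  proof -
    let ?z = "\<lambda>x. (1 - t) * v x + t * w x"
    have z: "?z \<in> admissible \<Omega> bc"
      using t by (intro admissible_convex[OF \<open>open \<Omega>\<close> v w]) auto
    \<comment> \<open>Almost everywhere linearity of the weak gradient links \<open>F t\<close> to
      the true step integrand, so minimality carries over under the integral.\<close>
    have FJ: "AE x in ?M. F t x = J ?z x"
      using H1_lincomb(2)[OF \<open>open \<Omega>\<close> H1, of "1 - t" t]
      by eventually_elim (simp add: F_def J_def step_integrand_def a_def b_def k_def)
    have J_meas: "J ?z \<in> borel_measurable ?M"
      unfolding J_def using z admissible_subset_H1 H1(2) by (intro step_integrand_measurable) auto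
    have "(\<integral>\<^sup>+x. ennreal (- F t x) \<partial>?M) = (\<integral>\<^sup>+x. ennreal (- J ?z x) \<partial>?M)"
      using FJ by (intro nn_integral_cong_AE) auto
    then have neg: "(\<integral>\<^sup>+x. ennreal (- F t x) \<partial>?M) < \<infinity>"
      using J_neg[OF z] by (rule ssubst)
    have "integrable ?M (\<lambda>x. (1 - t) * F 0 x + t * F 1 x)"
      unfolding F0 F1 by (intro Bochner_Integration.integrable_add integrable_mult_right Jv Jw)
    then have Ft: "integrable ?M (F t)"
      by (rule integrable_if_bounded_above[OF F_meas _ conv[OF t] neg])
    then have "integrable ?M (J ?z)"
      using integrable_cong_AE[OF F_meas J_meas FJ] by simp
    then have "(LINT x|?M. J v x) \<le> (LINT x|?M. J ?z x)"
      by (rule J_min[OF z])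
    also have "\<dots> = (LINT x|?M. F t x)"
      by (rule integral_cong_AE[OF F_meas J_meas FJ, symmetric])
    finally show ?thesis
      using Ft by (simp add: F0)
  qed
  have F_deriv: "((\<lambda>t. F t x) has_real_derivative D x) (at 0)" for x
  proof -
    have norm_eq: "(norm ((1 - t) *\<^sub>R a x + t *\<^sub>R b x))\<^sup>2
        = (norm (a x))\<^sup>2 + 2 * t * (a x \<bullet> (b x - a x)) + t\<^sup>2 * (norm (b x - a x))\<^sup>2" for t
      unfolding power2_norm_eq_inner
      by (simp add: inner_simps inner_commute algebra_simps power2_eq_square)
    have lin: "((\<lambda>t. (1 - t) * v x + t * w x) has_real_derivative w x - v x) (at 0)"
      by (auto intro!: derivative_eq_intros)
    have vex: "((\<lambda>t. Wvex ((1 - t) * v x + t * w x)) has_real_derivative deriv Wvex (v x) * (w x - v x)) (at 0)"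
      by (rule DERIV_chain2[OF _ lin]) (simp add: Wvex_deriv)
    have grad: "((\<lambda>t. (norm ((1 - t) *\<^sub>R a x + t *\<^sub>R b x))\<^sup>2) has_real_derivative
        2 * (a x \<bullet> (b x - a x))) (at 0)"
      unfolding norm_eq by (auto intro!: derivative_eq_intros)
    have quad: "((\<lambda>t. (((1 - t) * v x + t * w x) - w x)\<^sup>2) has_real_derivative
        - 2 * (w x - v x)\<^sup>2) (at 0)"
      by (auto intro!: derivative_eq_intros simp: power2_eq_square algebra_simps)
    have "((\<lambda>t. F t x) has_real_derivative \<epsilon> / 2 * (2 * (a x \<bullet> (b x - a x)))
        + (deriv Wvex (v x) * (w x - v x) + k x * (w x - v x)) / \<epsilon>
        + \<epsilon> / (2 * \<tau>) * (- 2 * (w x - v x)\<^sup>2)) (at 0)"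
      unfolding F_def by (intro DERIV_add DERIV_cdivide DERIV_cmult lin vex grad quad)
    then show ?thesis
      by (rule DERIV_cong) (simp add: D_def distrib_right)
  qed
  have "integrable ?M (F 0)" "integrable ?M (F 1)"
    using Jv Jw by (simp_all add: F0 F1)
  note FF = this F_int[THEN conjunct1] F_int[THEN conjunct2] conv F_deriv
  have D: "integrable ?M D" and D_nonneg: "0 \<le> integral\<^sup>L ?M D"
    by (rule integral_directional_derivative_nonneg[where F = F]; (rule FF; assumption?))+
  \<comment> \<open>The gradient part is expanded exactly; the squares of the gradient difference
    and of the increment over \<tau> are then discarded, so \<tau> drops out of the bound.\<close>
  have pointwise: "e v x + c / \<epsilon> * \<bar>v x - w x\<bar> powr p \<le> e w x - D x" for x
  proof -
    have "(norm (b x))\<^sup>2 = (norm (a x))\<^sup>2 + 2 * (a x \<bullet> (b x - a x)) + (norm (b x - a x))\<^sup>2"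
      by (simp add: power2_norm_eq_inner inner_simps inner_commute)
    then have "\<epsilon> / 2 * (norm (b x))\<^sup>2
        = \<epsilon> / 2 * (norm (a x))\<^sup>2 + \<epsilon> * (a x \<bullet> (b x - a x)) + \<epsilon> / 2 * (norm (b x - a x))\<^sup>2"
      by (simp add: distrib_left)
    moreover have "\<epsilon> / 2 * (norm (b x - a x))\<^sup>2 \<ge> 0"
      using pos by simp
    \<comment> \<open>The new iterate \<open>v\<close> takes the role of \<open>S\<close> and the
      old one \<open>w\<close> that of \<open>s\<close>, matching the implicit and explicit halves
      of the scheme.\<close>
    moreover have "(W (v x) + (deriv Wvex (v x) + k x) * (w x - v x) + c * \<bar>v x - w x\<bar> powr p) / \<epsilon> \<le> W (w x) / \<epsilon>"
      using curvature[of "v x" "w x"] pos by (intro divide_right_mono) (auto simp: k_def abs_minus_commute)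
    moreover have "\<epsilon> / \<tau> * (w x - v x)\<^sup>2 \<ge> 0"
      using pos by simp
    ultimately show ?thesis
      by (simp add: e_def D_def a_def b_def add_divide_distrib)
  qed
  have "energy \<Omega> \<epsilon> W v + ennreal (c / \<epsilon>) * (\<integral>\<^sup>+x. ennreal (\<bar>v x - w x\<bar> powr p) \<partial>?M)
      = (\<integral>\<^sup>+x. ennreal (e v x) + ennreal (c / \<epsilon>) * ennreal (\<bar>v x - w x\<bar> powr p) \<partial>?M)"
    by (simp add: energy_eq nn_integral_add nn_integral_cmult)
  also have "\<dots> = (\<integral>\<^sup>+x. ennreal (e v x + c / \<epsilon> * \<bar>v x - w x\<bar> powr p) \<partial>?M)"
    using e_nonneg c_pos pos by (intro nn_integral_cong) (simp del: times_divide_eq_left flip: ennreal_mult)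
  also have "\<dots> \<le> (\<integral>\<^sup>+x. ennreal (e w x - D x) \<partial>?M)"
    by (intro nn_integral_mono ennreal_leI pointwise)
  also have "\<dots> = ennreal (LINT x|?M. e w x - D x)"
  \<comment> \<open>\<open>pointwise\<close> bounds the integrand below by a nonnegative quantity,
    so \<open>ennreal\<close> truncates nothing.\<close>
  proof (rule nn_integral_eq_integral)
    have "0 \<le> e v x + c / \<epsilon> * \<bar>v x - w x\<bar> powr p" for x
      using e_nonneg c_pos pos by simp
    then show "AE x in ?M. 0 \<le> e w x - D x"
      using order_trans[OF _ pointwise] by blast
  qed (use ew D in simp)
  also have "\<dots> \<le> ennreal (LINT x|?M. e w x)"
    using ew D D_nonneg by (intro ennreal_leI) simp
  also have "\<dots> = energy \<Omega> \<epsilon> W w"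
    unfolding energy_eq using ew e_nonneg by (intro nn_integral_eq_integral[symmetric]) auto
  finally show ?thesis .
qed

end

section \<open>Summation over the time steps\<close>

text \<open>Jensen's inequality with equal weights: the p-th power of an average of m terms is at
  most the average of the p-th powers, and m^p / m gives the exponent p - 1.\<close>

lemma abs_sum_powr_le:
  fixes a :: "nat \<Rightarrow> real"
  assumes "p \<ge> 1"
  shows "\<bar>\<Sum>n<N. a n\<bar> powr p \<le> real N powr (p - 1) * (\<Sum>n<N. \<bar>a n\<bar> powr p)"
proof -
  \<comment> \<open>\<open>powr_convex\<close> is stated on the open half-line, hence the restriction to nonzero terms.\<close>
  define S where "S = {n. n < N \<and> a n \<noteq> 0}"
  have S: "finite S" "S \<subseteq> {..<N}"
    by (auto simp: S_def)
  have drop: "(\<Sum>n\<in>S. \<bar>a n\<bar>) = (\<Sum>n<N. \<bar>a n\<bar>)" "(\<Sum>n\<in>S. \<bar>a n\<bar> powr p) = (\<Sum>n<N. \<bar>a n\<bar> powr p)"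
    by (intro sum.mono_neutral_left; auto simp: S_def)+
  have le: "\<bar>\<Sum>n<N. a n\<bar> powr p \<le> (\<Sum>n\<in>S. \<bar>a n\<bar>) powr p"
    unfolding drop using assms by (intro powr_mono2 sum_abs) auto
  show ?thesis
  proof (cases "S = {}")
    case True
    then show ?thesis
      using le drop by (auto simp: sum_nonneg)
  next
    case False
    define m where "m = real (card S)"
    have m: "0 < m" "m \<le> real N"
      using False S card_mono[OF _ S(2)] by (auto simp: m_def card_gt_0_iff)
    have "(\<Sum>n\<in>S. (1 / m) *\<^sub>R \<bar>a n\<bar>) powr p \<le> (\<Sum>n\<in>S. (1 / m) * \<bar>a n\<bar> powr p)"
      using False S m(1)
      by (intro convex_on_sum[OF _ _ powr_convex[OF assms]]) (auto simp: S_def m_def)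
    then have "((\<Sum>n\<in>S. \<bar>a n\<bar>) / m) powr p \<le> (\<Sum>n\<in>S. \<bar>a n\<bar> powr p) / m"
      by (simp add: sum_divide_distrib)
    then have "(\<Sum>n\<in>S. \<bar>a n\<bar>) powr p \<le> m powr (p - 1) * (\<Sum>n\<in>S. \<bar>a n\<bar> powr p)"
      using m(1) by (simp add: powr_divide sum_nonneg powr_diff field_simps)
    \<comment> \<open>Jensen was applied to the \<open>m\<close> nonzero terms only;
      \<open>m \<le> real N\<close> restores the full count.\<close>
    also have "\<dots> \<le> real N powr (p - 1) * (\<Sum>n\<in>S. \<bar>a n\<bar> powr p)"
      using m assms by (intro mult_right_mono powr_mono2) (auto simp: sum_nonneg)
    finally show ?thesis
      using le drop by simp
  qed
qed

lemma (in convex_concave_splitting) scheme_dissipation: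
  assumes "open \<Omega>" "\<epsilon> > 0" "\<tau> > 0" "u 0 \<in> admissible \<Omega> bc"
    and scheme: "\<And>n. scheme_step \<Omega> bc \<epsilon> \<tau> Wvex Wconc (u n) (u (Suc n))"
    and fin: "energy \<Omega> \<epsilon> W (u 0) < \<infinity>"
  shows "energy \<Omega> \<epsilon> W (u N)
      + ennreal (c / \<epsilon>) * (\<Sum>n<N. \<integral>\<^sup>+x. ennreal (\<bar>u (Suc n) x - u n x\<bar> powr p) \<partial>lebesgue_on \<Omega>)
    \<le> energy \<Omega> \<epsilon> W (u 0)"
proof (induction N)
  case (Suc N)
  have adm: "u n \<in> admissible \<Omega> bc" for n
    using assms(4) scheme by (cases n) (auto simp: scheme_step_def)
  \<comment> \<open>Finite energy has to be carried through the induction because the one-step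
    estimate assumes it.\<close>
  have "energy \<Omega> \<epsilon> W (u N) \<le> energy \<Omega> \<epsilon> W (u 0)"
    by (rule order_trans[OF add_increasing2[OF zero_le order_refl] Suc.IH])
  then have "energy \<Omega> \<epsilon> W (u N) < \<infinity>"
    using fin by (rule le_less_trans)
  then have "energy \<Omega> \<epsilon> W (u (Suc N))
      + ennreal (c / \<epsilon>) * (\<integral>\<^sup>+x. ennreal (\<bar>u (Suc N) x - u N x\<bar> powr p) \<partial>lebesgue_on \<Omega>)
      \<le> energy \<Omega> \<epsilon> W (u N)"
    using scheme[of N] unfolding scheme_step_def
    by (intro step_minimizer_energy_decrease[OF assms(1-3) adm adm]) blast+
  from order_trans[OF add_right_mono[OF this] Suc.IH] show ?case
    by (simp add: distrib_left add_ac)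
qed simp

theorem corollary3p3:
  fixes \<Omega> :: "'a::euclidean_space set"
    and bc :: "'a boundary_condition"
    and W Wvex Wconc :: "real \<Rightarrow> real"
    and c p \<epsilon> \<tau> :: real
    and u :: "nat \<Rightarrow> 'a \<Rightarrow> real"
    and N :: nat
  assumes domain: "open \<Omega>" "connected \<Omega>" "\<Omega> \<noteq> {}"
    and bc: "valid_bc \<Omega> bc"
    and W_nonneg: "\<And>s. W s \<ge> 0"
    and W_zero: "\<And>s. W s = 0 \<longleftrightarrow> s \<in> {-1, 1}"
    and splitting: "\<And>s. W s = Wvex s + Wconc s"
    and convex: "convex_on UNIV Wvex"
    and concave: "concave_on UNIV Wconc"
    and C1: "Wvex C1_differentiable_on UNIV" "Wconc C1_differentiable_on UNIV"
    and c: "c > 0"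
    and p: "p \<ge> 2"
    and curvature: "\<And>s S. W s \<ge> W S + (deriv Wvex S + deriv Wconc s) * (s - S) + c * \<bar>s - S\<bar> powr p"
    and \<epsilon>: "\<epsilon> > 0"
    and \<tau>: "\<tau> > 0"
    and u0_H1: "u 0 \<in> H1 \<Omega>"
    and u0_bc: "u 0 \<in> admissible \<Omega> bc"
    and scheme: "\<And>n. scheme_step \<Omega> bc \<epsilon> \<tau> Wvex Wconc (u n) (u (Suc n))"
    and N: "N \<ge> 1"
  shows "Lp_norm \<Omega> p (\<lambda>x. u N x - u 0 x)
         \<le> ennpowr (energy \<Omega> \<epsilon> W (u 0) / ennreal c) (1 / p)
           * ennreal ((real N * \<epsilon> powr (1 / (p - 1))) powr (1 - 1 / p))"
proof (cases "energy \<Omega> \<epsilon> W (u 0) = \<infinity>")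
  case True
  then have "energy \<Omega> \<epsilon> W (u 0) / ennreal c = \<infinity>"
    using c by (simp add: ennreal_top_divide)
  \<comment> \<open>Strict positivity, hence \<open>N \<ge> 1\<close>, matters: in
    \<open>ennreal\<close> the product of \<infinity> and 0 is 0.\<close>
  moreover have "(real N * \<epsilon> powr (1 / (p - 1))) powr (1 - 1 / p) > 0"
    using N \<epsilon> by simp
  ultimately show ?thesis
    by (simp add: ennpowr_def ennreal_top_mult)
next
  case False
  let ?M = "lebesgue_on \<Omega>"
  interpret convex_concave_splitting W Wvex Wconc c p
    using W_nonneg splitting convex concave C1 c curvature by unfold_locales
  have fin: "energy \<Omega> \<epsilon> W (u 0) < \<infinity>"
    using False by (simp add: less_top)
  then obtain E where E: "energy \<Omega> \<epsilon> W (u 0) = ennreal E" "E \<ge> 0"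
    by (cases "energy \<Omega> \<epsilon> W (u 0)") auto
  have u_meas [measurable]: "u n \<in> borel_measurable ?M" for n
  proof -
    have "u n \<in> admissible \<Omega> bc"
      using u0_bc scheme by (cases n) (auto simp: scheme_step_def)
    then show ?thesis
      using subsetD[OF admissible_subset_H1] H1_L2(1) L2_def by blast
  qed
  define X where "X = (\<integral>\<^sup>+x. ennreal (\<bar>u N x - u 0 x\<bar> powr p) \<partial>?M)"
  define Y where "Y = (\<Sum>n<N. \<integral>\<^sup>+x. ennreal (\<bar>u (Suc n) x - u n x\<bar> powr p) \<partial>?M)"
  have "X \<le> (\<integral>\<^sup>+x. ennreal (real N powr (p - 1)) * (\<Sum>n<N. ennreal (\<bar>u (Suc n) x - u n x\<bar> powr p)) \<partial>?M)"
    unfolding X_def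
  proof (rule nn_integral_mono)
    fix x
    have "\<bar>u N x - u 0 x\<bar> powr p \<le> real N powr (p - 1) * (\<Sum>n<N. \<bar>u (Suc n) x - u n x\<bar> powr p)"
      using abs_sum_powr_le[of p "\<lambda>n. u (Suc n) x - u n x" N] p
      by (simp add: sum_lessThan_telescope[of "\<lambda>n. u n x"])
    then show "ennreal (\<bar>u N x - u 0 x\<bar> powr p)
        \<le> ennreal (real N powr (p - 1)) * (\<Sum>n<N. ennreal (\<bar>u (Suc n) x - u n x\<bar> powr p))"
      by (simp add: ennreal_leI sum_nonneg flip: ennreal_mult)
  qed
  also have "\<dots> = ennreal (real N powr (p - 1)) * Y"
    unfolding Y_def by (subst nn_integral_cmult, measurable, subst nn_integral_sum, measurable)
  finally have XY: "X \<le> ennreal (real N powr (p - 1)) * Y" .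
  \<comment> \<open>Only the increments are kept; the nonnegative final energy is discarded. Their
    weight \<open>c / \<epsilon>\<close> is the source of both the division by \<open>c\<close> and
    the power of \<epsilon> in the bound.\<close>
  have "ennreal (c / \<epsilon>) * Y \<le> ennreal E"
    using scheme_dissipation[OF domain(1) \<epsilon> \<tau> u0_bc scheme fin, of N]
    unfolding Y_def E(1) by (rule order_trans[OF add_increasing[OF zero_le order_refl]])
  then have "ennreal (\<epsilon> / c) * (ennreal (c / \<epsilon>) * Y) \<le> ennreal (\<epsilon> / c) * ennreal E"
    by (rule mult_left_mono) simp
  moreover have "ennreal (\<epsilon> / c) * (ennreal (c / \<epsilon>) * Y) = Y"
    using c \<epsilon> by (simp flip: mult.assoc ennreal_mult)
  ultimately have "Y \<le> ennreal (\<epsilon> / c * E)"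
    using c \<epsilon> E by (simp add: ennreal_mult del: times_divide_eq_left)
  from order_trans[OF XY mult_left_mono[OF this]]
  have X: "X \<le> ennreal (real N powr (p - 1) * (\<epsilon> / c * E))"
    using c \<epsilon> E by (simp add: ennreal_mult del: times_divide_eq_left)
  \<comment> \<open>Selects the finite branch of \<open>ennpowr\<close>.\<close>
  then have "X \<noteq> \<infinity>"
    by (metis ennreal_neq_top infinity_ennreal_def neq_top_trans)
  then have "Lp_norm \<Omega> p (\<lambda>x. u N x - u 0 x) = ennreal (enn2real X powr (1 / p))"
    by (simp add: Lp_norm_def ennpowr_def X_def)
  also have "\<dots> \<le> ennreal ((real N powr (p - 1) * (\<epsilon> / c * E)) powr (1 / p))"
    using X p c \<epsilon> E by (intro ennreal_leI powr_mono2 enn2real_leI) auto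
  also have "(real N powr (p - 1) * (\<epsilon> / c * E)) powr (1 / p)
      = (E / c) powr (1 / p) * (real N * \<epsilon> powr (1 / (p - 1))) powr (1 - 1 / p)"
  \<comment> \<open>The exponent 1 / (p - 1) is chosen so that multiplication by 1 - 1/p = (p - 1)/p
    leaves \<epsilon> with the power 1/p, while N gets (p - 1)/p.\<close>
  proof -
    have "(p - 1) * (1 / p) = 1 - 1 / p" "1 / (p - 1) * (1 - 1 / p) = 1 / p"
      using p by (simp_all add: field_simps)
    moreover have "real N powr (p - 1) * (\<epsilon> / c * E) = real N powr (p - 1) * (\<epsilon> * (E / c))"
      by simp
    ultimately show ?thesis
      using c \<epsilon> E N p by (simp only: powr_mult powr_powr mult_ac)
  qed
  also have "ennreal \<dots> = ennpowr (energy \<Omega> \<epsilon> W (u 0) / ennreal c) (1 / p)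
      * ennreal ((real N * \<epsilon> powr (1 / (p - 1))) powr (1 - 1 / p))"
    using c E by (simp add: ennpowr_def divide_ennreal ennreal_mult)
  finally show ?thesis .
qed

end
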